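(* Let $\sqsubset$ be a binary relation defined in the ground model $\mathcal{M}$ which is well founded in $\mathcal{M}$, with characteristic function $\langle x\sqsubset y\rangle\in\{0,1\}$. Then the relation $\mathcal{D}\langle x\sqsubset y\rangle$ (i.e. $\langle x\sqsubset y\rangle\,\varepsilon\,\mathcal{D}$) is well founded in the realizability model $\mathcal{N}$.
   Context: Classical realizability (Krivine): ground model $\mathcal{M}$ of ZF + V = L with a realizability algebra $(\Lambda,\Pi,\Lambda\star\Pi,\mathrm{QP},\perp\!\!\!\perp)$; $\mathcal{N}$ has the same individuals as $\mathcal{M}$; formulas of ZF$_\varepsilon$ (atomic $a\not\varepsilon b$, $a\notin b$, $a\subset b$, $\bot$; $\to,\forall$; function symbols defined in $\mathcal{M}$) get truth values $\|F\|\subseteq\Pi$ with $\|a\not\varepsilon b\|=\{\pi:(a,\pi)\in b\}$, $\|F\to G\|=\{\xi\cdot\pi:\xi\Vdash F,\pi\in\|G\|\}$, $\|\forall xF\|=\bigcup_a\|F[a]\|$; $\xi\Vdash F$ iff $\xi\star\pi\in\perp\!\!\!\perp$ for all $\pi\in\|F\|$; a formula holds in $\mathcal{N}$ if realized by a proof-like term. $\|R\hookrightarrow F\|=\|F\|$ if the $\mathcal{M}$-relation $R$ holds, $\emptyset$ otherwise. $\beth2=\{0,1\}\times\Pi$ is a Boolean algebra in $\mathcal{N}$ with operations extended from $\{0,1\}$; characteristic functions of $\mathcal{M}$-relations take values in $\beth2$ in $\mathcal{N}$. $\langle y<x\rangle$ is the characteristic function of $y\in\mathrm{Cl}(x)$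 in $\mathcal{M}$; $\mathcal{D}[\alpha]\equiv\forall X(\forall x(\forall y(\langle y<x\rangle\ge\alpha\hookrightarrow y\not\varepsilon X)\to x\not\varepsilon X)\to\forall x(x\not\varepsilon X))$ and $\mathcal{D}=\{\alpha\,\varepsilon\,\beth2:\mathcal{D}[\alpha]\}$ (an ultrafilter on $\beth2$ in $\mathcal{N}$). A relation $R$ is well founded in $\mathcal{N}$ when $\forall X(\forall x(\forall y(R(y,x)\to y\not\varepsilon X)\to x\not\varepsilon X)\to\forall x(x\not\varepsilon X))$ holds in $\mathcal{N}$. *)

theory Defs
  imports Main
begin

section \<open>The ground model\<close>

text \<open>
  The ground model is a structure (M, E): M is the type \<open>'m\<close> and E is its membership relation,
  so that \<open>E x y\<close> says that x is an element of y in the sense of M. It may be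
  non-well-founded and of any infinite cardinality; hence the schemes of ZF must range over the
  first-order definable classes of (M, E) only, and not over all HOL predicates.
\<close>

datatype fm = Mem nat nat | Equal nat nat | Neg fm | And fm fm | Forall fm

text \<open>De Bruijn indices: \<open>case_nat a s\<close> is the valuation s shifted, with a at index 0.\<close>

primrec sat :: "('m \<Rightarrow> 'm \<Rightarrow> bool) \<Rightarrow> fm \<Rightarrow> (nat \<Rightarrow> 'm) \<Rightarrow> bool" where
  "sat E (Mem i j) s \<longleftrightarrow> E (s i) (s j)"
| "sat E (Equal i j) s \<longleftrightarrow> s i = s j"
| "sat E (Neg p) s \<longleftrightarrow> \<not> sat E p s"
| "sat E (And p q) s \<longleftrightarrow> sat E p s \<and> sat E q s"
| "sat E (Forall p) s \<longleftrightarrow> (\<forall>a. sat E p (case_nat a s))"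

text \<open>Definability is with parameters: these are the values of the valuation s.\<close>

definition definable1 :: "('m \<Rightarrow> 'm \<Rightarrow> bool) \<Rightarrow> ('m \<Rightarrow> bool) \<Rightarrow> bool" where
  "definable1 E P \<longleftrightarrow> (\<exists>p s. \<forall>x. P x \<longleftrightarrow> sat E p (case_nat x s))"

definition definable2 :: "('m \<Rightarrow> 'm \<Rightarrow> bool) \<Rightarrow> ('m \<Rightarrow> 'm \<Rightarrow> bool) \<Rightarrow> bool" where
  "definable2 E R \<longleftrightarrow> (\<exists>p s. \<forall>x y. R x y \<longleftrightarrow> sat E p (case_nat x (case_nat y s)))"

definition model_ZF :: "('m \<Rightarrow> 'm \<Rightarrow> bool) \<Rightarrow> bool" where
  "model_ZF E \<longleftrightarrow>
    \<comment> \<open>extensionality\<close>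
    (\<forall>x y. (\<forall>z. E z x \<longleftrightarrow> E z y) \<longrightarrow> x = y) \<and>
    \<comment> \<open>foundation\<close>
    (\<forall>x. (\<exists>y. E y x) \<longrightarrow> (\<exists>y. E y x \<and> \<not> (\<exists>z. E z x \<and> E z y))) \<and>
    \<comment> \<open>pairing\<close>
    (\<forall>x y. \<exists>u. \<forall>z. E z u \<longleftrightarrow> z = x \<or> z = y) \<and>
    \<comment> \<open>union\<close>
    (\<forall>x. \<exists>u. \<forall>z. E z u \<longleftrightarrow> (\<exists>y. E y x \<and> E z y)) \<and>
    \<comment> \<open>power set\<close>
    (\<forall>x. \<exists>u. \<forall>z. E z u \<longleftrightarrow> (\<forall>y. E y z \<longrightarrow> E y x)) \<and>
    \<comment> \<open>infinity\<close>
    (\<exists>w. (\<exists>e. E e w \<and> (\<forall>z. \<not> E z e)) \<and>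
         (\<forall>x. E x w \<longrightarrow> (\<exists>y. E y w \<and> (\<forall>z. E z y \<longleftrightarrow> E z x \<or> z = x)))) \<and>
    \<comment> \<open>separation\<close>
    (\<forall>P. definable1 E P \<longrightarrow> (\<forall>x. \<exists>u. \<forall>z. E z u \<longleftrightarrow> E z x \<and> P z)) \<and>
    \<comment> \<open>replacement\<close>
    (\<forall>R. definable2 E R \<longrightarrow>
      (\<forall>x. (\<forall>y. E y x \<longrightarrow> (\<exists>!z. R y z)) \<longrightarrow> (\<exists>u. \<forall>z. E z u \<longleftrightarrow> (\<exists>y. E y x \<and> R y z))))"

text \<open>
  \<open>setof E P\<close> is the element of M whose members are exactly the x with P x. It is meaningful
  only if there is one; in a model of ZF this is so wherever it is used below.
\<close>

definition setof :: "('m \<Rightarrow> 'm \<Rightarrow> bool) \<Rightarrow> ('m \<Rightarrow> bool) \<Rightarrow> 'm" where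
  "setof E P = (THE a. \<forall>x. E x a \<longleftrightarrow> P x)"

definition subset :: "('m \<Rightarrow> 'm \<Rightarrow> bool) \<Rightarrow> 'm \<Rightarrow> 'm \<Rightarrow> bool" where
  "subset E x y \<longleftrightarrow> (\<forall>z. E z x \<longrightarrow> E z y)"

definition zero :: "('m \<Rightarrow> 'm \<Rightarrow> bool) \<Rightarrow> 'm" where
  "zero E = setof E (\<lambda>x. False)"

definition succ :: "('m \<Rightarrow> 'm \<Rightarrow> bool) \<Rightarrow> 'm \<Rightarrow> 'm" where
  "succ E x = setof E (\<lambda>z. E z x \<or> z = x)"

definition one :: "('m \<Rightarrow> 'm \<Rightarrow> bool) \<Rightarrow> 'm" where
  "one E = succ E (zero E)"

definition upair :: "('m \<Rightarrow> 'm \<Rightarrow> bool) \<Rightarrow> 'm \<Rightarrow> 'm \<Rightarrow> 'm" where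
  "upair E x y = setof E (\<lambda>z. z = x \<or> z = y)"

definition opair :: "('m \<Rightarrow> 'm \<Rightarrow> bool) \<Rightarrow> 'm \<Rightarrow> 'm \<Rightarrow> 'm" where
  "opair E x y = upair E (upair E x x) (upair E x y)"

definition times :: "('m \<Rightarrow> 'm \<Rightarrow> bool) \<Rightarrow> 'm \<Rightarrow> 'm \<Rightarrow> 'm" where
  "times E a b = setof E (\<lambda>p. \<exists>x y. E x a \<and> E y b \<and> p = opair E x y)"

definition maps :: "('m \<Rightarrow> 'm \<Rightarrow> bool) \<Rightarrow> 'm \<Rightarrow> 'm \<Rightarrow> 'm \<Rightarrow> bool" where
  "maps E f a b \<longleftrightarrow>
    (\<forall>p. E p f \<longrightarrow> (\<exists>x y. E x a \<and> E y b \<and> p = opair E x y)) \<and>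
    (\<forall>x. E x a \<longrightarrow> (\<exists>!y. E (opair E x y) f))"

definition val :: "('m \<Rightarrow> 'm \<Rightarrow> bool) \<Rightarrow> 'm \<Rightarrow> 'm \<Rightarrow> 'm" where
  "val E f x = (THE y. E (opair E x y) f)"

definition transitive :: "('m \<Rightarrow> 'm \<Rightarrow> bool) \<Rightarrow> 'm \<Rightarrow> bool" where
  "transitive E x \<longleftrightarrow> (\<forall>y. E y x \<longrightarrow> subset E y x)"

definition ordinal :: "('m \<Rightarrow> 'm \<Rightarrow> bool) \<Rightarrow> 'm \<Rightarrow> bool" where
  "ordinal E x \<longleftrightarrow> transitive E x \<and> (\<forall>y. E y x \<longrightarrow> transitive E y)"

definition natural :: "('m \<Rightarrow> 'm \<Rightarrow> bool) \<Rightarrow> 'm \<Rightarrow> bool" where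
  "natural E n \<longleftrightarrow>
    ordinal E n \<and> (\<forall>m. E m n \<or> m = n \<longrightarrow> m = zero E \<or> (\<exists>k. m = succ E k))"


section \<open>The axiom V = L\<close>

text \<open>
  First-order definability over a set a has to be formalized inside M, whose natural numbers may
  be nonstandard. As in Kunen's textbook, the definable n-ary relations on a form the least
  family of pairs (n, r) with r a set of n-tuples of a (maps from n to a) that contains the
  diagonal relations of membership and equality and is closed under complement, intersection
  and projection.
\<close>

definition def_closed :: "('m \<Rightarrow> 'm \<Rightarrow> bool) \<Rightarrow> 'm \<Rightarrow> 'm \<Rightarrow> bool" where
  "def_closed E a F \<longleftrightarrow>
    (\<forall>n i j. natural E n \<and> E i n \<and> E j n \<longrightarrow>
      E (opair E n (setof E (\<lambda>s. maps E s n a \<and> E (val E s i) (val E s j)))) F) \<and>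
    (\<forall>n i j. natural E n \<and> E i n \<and> E j n \<longrightarrow>
      E (opair E n (setof E (\<lambda>s. maps E s n a \<and> val E s i = val E s j))) F) \<and>
    (\<forall>n r. natural E n \<and> E (opair E n r) F \<longrightarrow>
      E (opair E n (setof E (\<lambda>s. maps E s n a \<and> \<not> E s r))) F) \<and>
    (\<forall>n r r'. natural E n \<and> E (opair E n r) F \<and> E (opair E n r') F \<longrightarrow>
      E (opair E n (setof E (\<lambda>s. E s r \<and> E s r'))) F) \<and>
    (\<forall>n r. natural E n \<and> E (opair E (succ E n) r) F \<longrightarrow>
      E (opair E n (setof E (\<lambda>s. maps E s n a \<and> (\<exists>t. E t r \<and> subset E s t)))) F)"

definition def_rel :: "('m \<Rightarrow> 'm \<Rightarrow> bool) \<Rightarrow> 'm \<Rightarrow> 'm \<Rightarrow> 'm \<Rightarrow> bool" where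
  "def_rel E a n r \<longleftrightarrow> natural E n \<and> (\<forall>F. def_closed E a F \<longrightarrow> E (opair E n r) F)"

text \<open>
  x is a subset of a definable over a with parameters: x is the set of those z in a for which
  the (n+1)-tuple t extending s by z lies in a definable relation r.
\<close>

definition def_subset :: "('m \<Rightarrow> 'm \<Rightarrow> bool) \<Rightarrow> 'm \<Rightarrow> 'm \<Rightarrow> bool" where
  "def_subset E a x \<longleftrightarrow>
    (\<exists>n s r. natural E n \<and> maps E s n a \<and> def_rel E a (succ E n) r \<and>
      (\<forall>z. E z x \<longleftrightarrow> E z a \<and> (\<exists>t. E t r \<and> subset E s t \<and> E (opair E n z) t)))"

text \<open>
  f is the sequence of the \<open>L\<^sub>\<beta>\<close> for \<open>\<beta> \<le> \<alpha>\<close>, where \<open>L\<^sub>\<beta>\<close> is the union of the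
  sets of definable subsets of the \<open>L\<^sub>\<gamma>\<close> for \<open>\<gamma> < \<beta>\<close>.
\<close>

definition constructible :: "('m \<Rightarrow> 'm \<Rightarrow> bool) \<Rightarrow> 'm \<Rightarrow> bool" where
  "constructible E x \<longleftrightarrow>
    (\<exists>\<alpha> f b. ordinal E \<alpha> \<and> maps E f (succ E \<alpha>) b \<and>
      (\<forall>\<beta>. E \<beta> (succ E \<alpha>) \<longrightarrow>
        (\<forall>z. E z (val E f \<beta>) \<longleftrightarrow> (\<exists>\<gamma>. E \<gamma> \<beta> \<and> def_subset E (val E f \<gamma>) z))) \<and>
      E x (val E f \<alpha>))"

definition V_eq_L :: "('m \<Rightarrow> 'm \<Rightarrow> bool) \<Rightarrow> bool" where
  "V_eq_L E \<longleftrightarrow> (\<forall>x. constructible E x)"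


section \<open>Realizability algebras\<close>

text \<open>A realizability algebra is an object of M: all the components are sets of M.\<close>

record 'm realg =
  terms :: 'm
  stacks :: 'm
  procs :: 'm
  app_fun :: 'm
  push_fun :: 'm
  star_fun :: 'm
  cont_fun :: 'm
  cB :: 'm
  cC :: 'm
  cI :: 'm
  cK :: 'm
  cW :: 'm
  cc :: 'm
  QP :: 'm
  pole :: 'm

definition app :: "('m \<Rightarrow> 'm \<Rightarrow> bool) \<Rightarrow> 'm realg \<Rightarrow> 'm \<Rightarrow> 'm \<Rightarrow> 'm" where
  "app E A \<xi> \<eta> = val E (app_fun A) (opair E \<xi> \<eta>)"

definition push :: "('m \<Rightarrow> 'm \<Rightarrow> bool) \<Rightarrow> 'm realg \<Rightarrow> 'm \<Rightarrow> 'm \<Rightarrow> 'm" where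
  "push E A \<xi> \<pi> = val E (push_fun A) (opair E \<xi> \<pi>)"

definition star :: "('m \<Rightarrow> 'm \<Rightarrow> bool) \<Rightarrow> 'm realg \<Rightarrow> 'm \<Rightarrow> 'm \<Rightarrow> 'm" where
  "star E A \<xi> \<pi> = val E (star_fun A) (opair E \<xi> \<pi>)"

definition cont :: "('m \<Rightarrow> 'm \<Rightarrow> bool) \<Rightarrow> 'm realg \<Rightarrow> 'm \<Rightarrow> 'm" where
  "cont E A \<pi> = val E (cont_fun A) \<pi>"

text \<open>
  One step of execution. The rule for B is the usual one up to the evaluation of an application,
  and a further instruction E with \<open>E \<star> \<xi>\<cdot>\<eta>\<cdot>\<pi>\<close> reducing to \<open>(\<xi>)\<eta> \<star> \<pi>\<close> may be
  present but is not required; so every algebra in either of the usual presentations is covered.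
\<close>

inductive exec :: "('m \<Rightarrow> 'm \<Rightarrow> bool) \<Rightarrow> 'm realg \<Rightarrow> 'm \<Rightarrow> 'm \<Rightarrow> bool"
  for E :: "'m \<Rightarrow> 'm \<Rightarrow> bool" and A :: "'m realg" where
  app: "\<lbrakk>E \<xi> (terms A); E \<eta> (terms A); E \<pi> (stacks A)\<rbrakk>
    \<Longrightarrow> exec E A (star E A (app E A \<xi> \<eta>) \<pi>) (star E A \<xi> (push E A \<eta> \<pi>))"
| B: "\<lbrakk>E \<xi> (terms A); E \<eta> (terms A); E \<zeta> (terms A); E \<pi> (stacks A)\<rbrakk>
    \<Longrightarrow> exec E A (star E A (cB A) (push E A \<xi> (push E A \<eta> (push E A \<zeta> \<pi>))))
          (star E A \<xi> (push E A (app E A \<eta> \<zeta>) \<pi>))"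
| C: "\<lbrakk>E \<xi> (terms A); E \<eta> (terms A); E \<zeta> (terms A); E \<pi> (stacks A)\<rbrakk>
    \<Longrightarrow> exec E A (star E A (cC A) (push E A \<xi> (push E A \<eta> (push E A \<zeta> \<pi>))))
          (star E A \<xi> (push E A \<zeta> (push E A \<eta> \<pi>)))"
| I: "\<lbrakk>E \<xi> (terms A); E \<pi> (stacks A)\<rbrakk>
    \<Longrightarrow> exec E A (star E A (cI A) (push E A \<xi> \<pi>)) (star E A \<xi> \<pi>)"
| K: "\<lbrakk>E \<xi> (terms A); E \<eta> (terms A); E \<pi> (stacks A)\<rbrakk>
    \<Longrightarrow> exec E A (star E A (cK A) (push E A \<xi> (push E A \<eta> \<pi>))) (star E A \<xi> \<pi>)"
| W: "\<lbrakk>E \<xi> (terms A); E \<eta> (terms A); E \<pi> (stacks A)\<rbrakk>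
    \<Longrightarrow> exec E A (star E A (cW A) (push E A \<xi> (push E A \<eta> \<pi>)))
          (star E A \<xi> (push E A \<eta> (push E A \<eta> \<pi>)))"
| cc: "\<lbrakk>E \<xi> (terms A); E \<pi> (stacks A)\<rbrakk>
    \<Longrightarrow> exec E A (star E A (cc A) (push E A \<xi> \<pi>)) (star E A \<xi> (push E A (cont E A \<pi>) \<pi>))"
| cont: "\<lbrakk>E \<xi> (terms A); E \<pi> (stacks A); E \<rho> (stacks A)\<rbrakk>
    \<Longrightarrow> exec E A (star E A (cont E A \<pi>) (push E A \<xi> \<rho>)) (star E A \<xi> \<pi>)"

definition realizability_algebra :: "('m \<Rightarrow> 'm \<Rightarrow> bool) \<Rightarrow> 'm realg \<Rightarrow> bool" where
  "realizability_algebra E A \<longleftrightarrow>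
    maps E (app_fun A) (times E (terms A) (terms A)) (terms A) \<and>
    maps E (push_fun A) (times E (terms A) (stacks A)) (stacks A) \<and>
    maps E (star_fun A) (times E (terms A) (stacks A)) (procs A) \<and>
    maps E (cont_fun A) (stacks A) (terms A) \<and>
    subset E (QP A) (terms A) \<and>
    (\<forall>\<xi> \<in> {cB A, cC A, cI A, cK A, cW A, cc A}. E \<xi> (QP A)) \<and>
    (\<forall>\<xi> \<eta>. E \<xi> (QP A) \<and> E \<eta> (QP A) \<longrightarrow> E (app E A \<xi> \<eta>) (QP A)) \<and>
    subset E (pole A) (procs A) \<and>
    (\<forall>p q. exec E A p q \<and> E q (pole A) \<longrightarrow> E p (pole A))"


section \<open>Formulas and their truth values\<close>

text \<open>
  Closed formulas of \<open>ZF\<^sub>\<epsilon>\<close> with parameters in M. Bound variables range over the individuals,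
  which are all the elements of M, so a quantified formula is given by its instances, and a
  function symbol defined in M by its values. \<open>Cond R F\<close> is \<open>R \<hookrightarrow> F\<close>. The atomic formulas
  of extensional membership and inclusion are left out, since the notions below are formulated
  with \<open>\<epsilon>\<close> only.
\<close>

datatype 'm zfe =
    NotEps 'm 'm
  | Bot
  | Imp "'m zfe" "'m zfe"
  | All "'m \<Rightarrow> 'm zfe"
  | Cond bool "'m zfe"

primrec tv :: "('m \<Rightarrow> 'm \<Rightarrow> bool) \<Rightarrow> 'm realg \<Rightarrow> 'm zfe \<Rightarrow> 'm set" where
  "tv E A (NotEps a b) = {\<pi>. E \<pi> (stacks A) \<and> E (opair E a \<pi>) b}"
| "tv E A Bot = {\<pi>. E \<pi> (stacks A)}"
| "tv E A (Imp F G) =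
    {push E A \<xi> \<pi> | \<xi> \<pi>. E \<xi> (terms A) \<and> (\<forall>\<rho> \<in> tv E A F. E (star E A \<xi> \<rho>) (pole A)) \<and> \<pi> \<in> tv E A G}"
| "tv E A (All F) = (\<Union>a. tv E A (F a))"
| "tv E A (Cond R F) = (if R then tv E A F else {})"

definition realizes :: "('m \<Rightarrow> 'm \<Rightarrow> bool) \<Rightarrow> 'm realg \<Rightarrow> 'm \<Rightarrow> 'm zfe \<Rightarrow> bool" where
  "realizes E A \<xi> F \<longleftrightarrow> E \<xi> (terms A) \<and> (\<forall>\<pi> \<in> tv E A F. E (star E A \<xi> \<pi>) (pole A))"

definition holds :: "('m \<Rightarrow> 'm \<Rightarrow> bool) \<Rightarrow> 'm realg \<Rightarrow> 'm zfe \<Rightarrow> bool" where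
  "holds E A F \<longleftrightarrow> (\<exists>\<xi>. E \<xi> (QP A) \<and> realizes E A \<xi> F)"

definition Not :: "'m zfe \<Rightarrow> 'm zfe" where
  "Not F = Imp F Bot"

definition Conj :: "'m zfe \<Rightarrow> 'm zfe \<Rightarrow> 'm zfe" where
  "Conj F G = Not (Imp F (Not G))"

definition Eps :: "'m \<Rightarrow> 'm \<Rightarrow> 'm zfe" where
  "Eps a b = Not (NotEps a b)"


section \<open>Well-founded relations and the ultrafilter\<close>

definition wf_ground :: "('m \<Rightarrow> 'm \<Rightarrow> bool) \<Rightarrow> ('m \<Rightarrow> 'm \<Rightarrow> bool) \<Rightarrow> bool" where
  "wf_ground E R \<longleftrightarrow> (\<forall>X. (\<forall>x. (\<forall>y. R y x \<longrightarrow> \<not> E y X) \<longrightarrow> \<not> E x X) \<longrightarrow> (\<forall>x. \<not> E x X))"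

definition wf_formula :: "('m \<Rightarrow> 'm \<Rightarrow> 'm zfe) \<Rightarrow> 'm zfe" where
  "wf_formula R =
    All (\<lambda>X. Imp (All (\<lambda>x. Imp (All (\<lambda>y. Imp (R y x) (NotEps y X))) (NotEps x X)))
                 (All (\<lambda>x. NotEps x X)))"

definition chi :: "('m \<Rightarrow> 'm \<Rightarrow> bool) \<Rightarrow> ('m \<Rightarrow> 'm \<Rightarrow> bool) \<Rightarrow> 'm \<Rightarrow> 'm \<Rightarrow> 'm" where
  "chi E R x y = (if R x y then one E else zero E)"

text \<open>\<open>{0,1} \<times> \<Pi>\<close>\<close>

definition gimel2 :: "('m \<Rightarrow> 'm \<Rightarrow> bool) \<Rightarrow> 'm realg \<Rightarrow> 'm" where
  "gimel2 E A = times E (upair E (zero E) (one E)) (stacks A)"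

text \<open>The order \<open>u \<ge> v\<close> of the Boolean algebra {0,1} of M.\<close>

definition bool_ge :: "('m \<Rightarrow> 'm \<Rightarrow> bool) \<Rightarrow> 'm \<Rightarrow> 'm \<Rightarrow> bool" where
  "bool_ge E u v \<longleftrightarrow>
    u \<in> {zero E, one E} \<and> v \<in> {zero E, one E} \<and> (u = one E \<or> v = zero E)"

text \<open>
  y belongs to the transitive closure Cl(x), the least transitive set that includes x as a
  subset. In general x itself is not a member of Cl(x).
\<close>

definition below :: "('m \<Rightarrow> 'm \<Rightarrow> bool) \<Rightarrow> 'm \<Rightarrow> 'm \<Rightarrow> bool" where
  "below E y x \<longleftrightarrow> (\<forall>t. transitive E t \<and> subset E x t \<longrightarrow> E y t)"

definition D_formula :: "('m \<Rightarrow> 'm \<Rightarrow> bool) \<Rightarrow> 'm \<Rightarrow> 'm zfe" where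
  "D_formula E \<alpha> =
    All (\<lambda>X. Imp (All (\<lambda>x. Imp (All (\<lambda>y. Cond (bool_ge E (chi E (below E) y x) \<alpha>) (NotEps y X)))
                               (NotEps x X)))
                 (All (\<lambda>x. NotEps x X)))"

text \<open>The formula \<open>\<alpha> \<epsilon> D\<close>, where D is the class of the \<open>\<alpha> \<epsilon> gimel2\<close> with \<open>D[\<alpha>]\<close>.\<close>

definition Eps_D :: "('m \<Rightarrow> 'm \<Rightarrow> bool) \<Rightarrow> 'm realg \<Rightarrow> 'm \<Rightarrow> 'm zfe" where
  "Eps_D E A \<alpha> = Conj (Eps \<alpha> (gimel2 E A)) (D_formula E \<alpha>)"

end

theory Submission
  imports Defs
begin

text \<open>Write \<open>D[\<alpha>]\<close> for D_formula. Every individual \<open>\<alpha>\<close> of \<open>{0,1}\<close> is 0 or 1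
  in M, but one realizer must serve both values, so the argument has to be carried out in the logic
  of the realizability model.

  (1) \<open>D[\<alpha>]\<close> and \<open>D[\<not>\<alpha>]\<close> are contradictory. If both orders
  \<open>\<langle>y<x\<rangle> \<ge> \<alpha>\<close> and \<open>\<langle>y<x\<rangle> \<ge> \<not>\<alpha>\<close> were well founded, their ranks on an ordinal \<open>\<kappa>\<close> of M could be
  compared. Both outcomes are refuted by a pigeonhole argument in M, where \<open>\<kappa>\<close> is not an image of the
  set of terms.

  (2) Suppose that X has no minimal element for \<open>D\<langle>x\<sqsubset>y\<rangle>\<close>. Consider triples of an x in X, a Boolean
  \<open>\<beta>\<close>, and an element u of a set Y that has no minimal element along \<open>\<not>\<beta>\<close>. There is y in X with
  \<open>\<gamma> = \<langle>y\<sqsubset>x\<rangle>\<close> in D; by (1) some set Z has no minimal element along \<open>\<not>\<gamma>\<close>. Replacing \<open>\<beta>\<close> by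
  \<open>\<beta>\<gamma>\<close>, and Y by a product of Y and Z, yields a new triple that is smaller, in M, for the relation
  \<open>\<sqsubset>\<close> on x where \<open>\<beta> = 1\<close>, followed by membership in the transitive closure on u where \<open>\<beta> = 0\<close>.
  A fixed point combinator thus realizes the contradiction.\<close>

section \<open>Definable predicates\<close>

primrec ren :: "(nat \<Rightarrow> nat) \<Rightarrow> fm \<Rightarrow> fm" where
  "ren r (Mem i j) = Mem (r i) (r j)"
| "ren r (Equal i j) = Equal (r i) (r j)"
| "ren r (Neg p) = Neg (ren r p)"
| "ren r (And p q) = And (ren r p) (ren r q)"
| "ren r (Forall p) = Forall (ren (case_nat 0 (\<lambda>i. Suc (r i))) p)"

lemma sat_ren: "sat E (ren r p) s \<longleftrightarrow> sat E p (\<lambda>i. s (r i))"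
proof (induction p arbitrary: r s)
  case (Forall p)
  have "(\<lambda>i. case_nat a s (case_nat 0 (\<lambda>i. Suc (r i)) i)) = case_nat a (\<lambda>i. s (r i))" for a
    by (auto simp: fun_eq_iff split: nat.split)
  then show ?case by (simp add: Forall)
qed auto

text \<open>The even positions of a valuation hold the arguments, the odd ones the parameters.\<close>

definition mix :: "(nat \<Rightarrow> 'm) \<Rightarrow> (nat \<Rightarrow> 'm) \<Rightarrow> nat \<Rightarrow> 'm" where
  "mix s c i = (if even i then s (i div 2) else c (i div 2))"

lemma mix_simps [simp]: "mix s c (2 * i) = s i" "mix s c (Suc (2 * i)) = c i"
  by (auto simp: mix_def)

text \<open>A predicate takes a whole valuation, so its arity is never tracked; only the parameters
  \<open>c\<close> are hidden.\<close>

definition dp :: "('m \<Rightarrow> 'm \<Rightarrow> bool) \<Rightarrow> ((nat \<Rightarrow> 'm) \<Rightarrow> bool) \<Rightarrow> bool" where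
  "dp E P \<longleftrightarrow> (\<exists>p c. \<forall>s. P s \<longleftrightarrow> sat E p (mix s c))"

definition df :: "('m \<Rightarrow> 'm \<Rightarrow> bool) \<Rightarrow> ((nat \<Rightarrow> 'm) \<Rightarrow> 'm) \<Rightarrow> bool" where
  "df E f \<longleftrightarrow> dp E (\<lambda>s. s 0 = f (\<lambda>i. s (Suc i)))"

section \<open>Closure of definable predicates under logic and substitution\<close>

lemma dp_raw:
  assumes "\<And>s. P s \<longleftrightarrow> sat E p (\<lambda>i. mix s c (r i))"
  shows "dp E P"
  unfolding dp_def using assms sat_ren[of E r p] by metis

lemma dp_ren:
  assumes "dp E P" shows "dp E (\<lambda>s. P (\<lambda>i. s (r i)))"
proof -
  obtain p c where p: "\<And>s. P s \<longleftrightarrow> sat E p (mix s c)" using assms by (auto simp: dp_def)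
  have "mix (\<lambda>i. s (r i)) c = (\<lambda>i. mix s c (if even i then 2 * r (i div 2) else i))" for s
    by (auto simp: fun_eq_iff mix_def)
  then show ?thesis by (intro dp_raw[where p = p and c = c]) (simp add: p)
qed

lemma dp_mem_var: "dp E (\<lambda>s. E (s i) (s j))"
  by (rule dp_raw[of _ _ "Mem (2 * i) (2 * j)" undefined "\<lambda>i. i"]) simp

lemma dp_eq_var: "dp E (\<lambda>s. s i = s j)"
  by (rule dp_raw[of _ _ "Equal (2 * i) (2 * j)" undefined "\<lambda>i. i"]) simp

lemma dp_not: assumes "dp E P" shows "dp E (\<lambda>s. \<not> P s)"
proof -
  obtain p c where "\<And>s. P s \<longleftrightarrow> sat E p (mix s c)" using assms by (auto simp: dp_def)
  then show ?thesis by (intro dp_raw[of _ _ "Neg p" c "\<lambda>i. i"]) simp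
qed

text \<open>The two parameter sequences are interleaved by a second \<open>mix\<close>; each formula
  is renamed so as to read its own half.\<close>

lemma dp_conj: assumes "dp E P" "dp E Q" shows "dp E (\<lambda>s. P s \<and> Q s)"
proof -
  obtain p c where p: "\<And>s. P s \<longleftrightarrow> sat E p (mix s c)" using assms by (auto simp: dp_def)
  obtain q d where q: "\<And>s. Q s \<longleftrightarrow> sat E q (mix s d)" using assms by (auto simp: dp_def)
  let ?r = "\<lambda>k i. if even i then i else Suc (2 * (2 * (i div 2) + k))"
  have 1: "mix s c = (\<lambda>i. mix s (mix c d) (?r 0 i))" for s
    unfolding fun_eq_iff mix_def by (auto elim!: oddE)
  have 2: "mix s d = (\<lambda>i. mix s (mix c d) (?r 1 i))" for s
    unfolding fun_eq_iff mix_def by auto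
  show ?thesis
    unfolding dp_def
    by (rule exI[of _ "And (ren (?r 0) p) (ren (?r 1) q)"], rule exI[of _ "mix c d"])
       (simp only: p q 1[symmetric] 2[symmetric] sat.simps sat_ren simp_thms)
qed

text \<open>\<open>Forall\<close> shifts all positions by one and so exchanges the parities of
  arguments and parameters; the renaming \<open>?r\<close> restores the layout that the formula
  expects.\<close>

lemma dp_all: assumes "dp E (\<lambda>s. P (\<lambda>i. s (Suc i)) (s 0))" shows "dp E (\<lambda>s. \<forall>a. P s a)"
proof -
  obtain p c where p: "\<And>s. P (\<lambda>i. s (Suc i)) (s 0) \<longleftrightarrow> sat E p (mix s c)"
    using assms by (auto simp: dp_def)
  let ?r = "\<lambda>i. if i = 0 then 0 else if even i then i - 1 else Suc i"
  have 1: "mix (case_nat a s) c = (\<lambda>i. case_nat a (mix s c) (?r i))" for a s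
  proof
    fix i show "mix (case_nat a s) c i = case_nat a (mix s c) (?r i)"
    proof (cases i)
      case (Suc j)
      then show ?thesis by (cases "even j") (auto simp: mix_def elim!: evenE oddE)
    qed (simp add: mix_def)
  qed
  show ?thesis unfolding dp_def
    by (rule exI[of _ "Forall (ren ?r p)"], rule exI[of _ c])
       (simp only: sat.simps sat_ren 1[symmetric] p[symmetric] nat.case simp_thms)
qed

lemma dp_imp: "dp E P \<Longrightarrow> dp E Q \<Longrightarrow> dp E (\<lambda>s. P s \<longrightarrow> Q s)"
  using dp_not[OF dp_conj[of E P "\<lambda>s. \<not> Q s"]] dp_not[of E Q] by simp

lemma dp_disj: "dp E P \<Longrightarrow> dp E Q \<Longrightarrow> dp E (\<lambda>s. P s \<or> Q s)"
  using dp_imp[of E "\<lambda>s. \<not> P s" Q] dp_not[of E P] by (simp add: disj_imp)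

lemma dp_iff: "dp E P \<Longrightarrow> dp E Q \<Longrightarrow> dp E (\<lambda>s. P s \<longleftrightarrow> Q s)"
  using dp_conj[OF dp_imp[of E P Q] dp_imp[of E Q P]] by (simp add: iff_conv_conj_imp)

lemma dp_ex: "dp E (\<lambda>s. P (\<lambda>i. s (Suc i)) (s 0)) \<Longrightarrow> dp E (\<lambda>s. \<exists>a. P s a)"
  using dp_not[OF dp_all[of E "\<lambda>s a. \<not> P s a"]] dp_not[of E "\<lambda>s. P (\<lambda>i. s (Suc i)) (s 0)"] by simp

lemma dp_const: "dp E (\<lambda>s. b)"
  using dp_eq_var[of E 0 0] dp_not[OF dp_eq_var[of E 0 0]] by (cases b) simp_all

lemma df_var: "df E (\<lambda>s. s i)"
  unfolding df_def by (rule dp_eq_var)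

lemma df_const: "df E (\<lambda>s. a)"
  unfolding df_def by (rule dp_raw[of _ _ "Equal 0 1" "\<lambda>_. a" "\<lambda>i. i"]) (simp add: mix_def)

lemma dp_subst:
  assumes "dp E P" "df E f" shows "dp E (\<lambda>s. P (case_nat (f s) s))"
proof -
  have "case_nat (s 0) (\<lambda>i. s (Suc i)) = s" for s :: "nat \<Rightarrow> 'a"
    by (auto simp: fun_eq_iff split: nat.split)
  then have "dp E (\<lambda>s. \<exists>a. a = f s \<and> P (case_nat a s))"
    using assms by (intro dp_ex dp_conj) (simp_all add: df_def)
  then show ?thesis by simp
qed

lemma df_ren: "df E f \<Longrightarrow> df E (\<lambda>s. f (\<lambda>i. s (r i)))"
  unfolding df_def using dp_ren[of E "\<lambda>s. s 0 = f (\<lambda>i. s (Suc i))" "case_nat 0 (\<lambda>i. Suc (r i))"] by simp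

lemma dp1:
  assumes "dp E (\<lambda>s. P (s 0))" "df E f" shows "dp E (\<lambda>s. P (f s))"
  using dp_subst[OF assms] by simp

lemma dp2:
  assumes "dp E (\<lambda>s. P (s 0) (s 1))" "df E f" "df E g" shows "dp E (\<lambda>s. P (f s) (g s))"
proof -
  have "dp E (\<lambda>s. P (f (\<lambda>i. s (Suc i))) (s 0))"
    using dp_subst[OF dp_ren[OF assms(1), of "case_nat 0 (\<lambda>i. Suc 0)"], of "\<lambda>s. f (\<lambda>i. s (Suc i))"]
      df_ren[OF assms(2)] by simp
  from dp_subst[OF this assms(3)] show ?thesis by simp
qed

lemma df2:
  assumes "dp E (\<lambda>s. s 0 = F (s 1) (s 2))" "df E f" "df E g" shows "df E (\<lambda>s. F (f s) (g s))"
proof -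
  have "dp E (\<lambda>s. s 0 = F (s (Suc 0)) (g (\<lambda>i. s (Suc (Suc i)))))"
    using dp_subst[OF dp_ren[OF assms(1), of "case_nat 1 (case_nat 2 (\<lambda>_. 0))"],
        of "\<lambda>s. g (\<lambda>i. s (Suc (Suc i)))"] df_ren[OF assms(3), of "\<lambda>i. Suc (Suc i)"]
    by (simp add: numeral_2_eq_2)
  then have "dp E (\<lambda>s. s (Suc 0) = F (s 0) (g (\<lambda>i. s (Suc (Suc i)))))"
    using dp_ren[of E "\<lambda>s. s 0 = F (s (Suc 0)) (g (\<lambda>i. s (Suc (Suc i))))"
        "case_nat 1 (case_nat 0 (\<lambda>i. Suc (Suc i)))"] by simp
  from dp_subst[OF this, of "\<lambda>s. f (\<lambda>i. s (Suc i))"] df_ren[OF assms(2)]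
  show ?thesis by (simp add: df_def)
qed

lemma dp_mem: "df E f \<Longrightarrow> df E g \<Longrightarrow> dp E (\<lambda>s. E (f s) (g s))"
  using dp2[of E E] dp_mem_var[of E 0 1] by simp

lemma dp_eq: "df E f \<Longrightarrow> df E g \<Longrightarrow> dp E (\<lambda>s. f s = g s)"
  using dp2[of E "(=)"] dp_eq_var[of E 0 1] by simp

lemmas dp_intros = dp_not dp_conj dp_all dp_imp dp_disj dp_iff dp_ex dp_const
  df_var df_const dp_mem dp_eq

section \<open>From valuations to classes and relations\<close>

lemma dp_definable1: assumes "dp E (\<lambda>s. P (s 0))" shows "definable1 E P"
proof -
  obtain p c where p: "\<And>s. P (s 0) \<longleftrightarrow> sat E p (mix s c)" using assms by (auto simp: dp_def)
  have 1: "mix (\<lambda>_. x) c = (\<lambda>i. case_nat x c (if even i then 0 else Suc (i div 2)))" for x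
    by (auto simp: fun_eq_iff mix_def)
  show ?thesis unfolding definable1_def
    by (rule exI[of _ "ren (\<lambda>i. if even i then 0 else Suc (i div 2)) p"], rule exI[of _ c])
       (simp only: sat_ren 1[symmetric] p[symmetric] simp_thms)
qed

lemma dp_definable2: assumes "dp E (\<lambda>s. P (s 0) (s 1))" shows "definable2 E P"
proof -
  obtain p c where p: "\<And>s. P (s 0) (s 1) \<longleftrightarrow> sat E p (mix s c)" using assms by (auto simp: dp_def)
  let ?r = "\<lambda>i. if even i then if i = 0 then 0 else 1 else Suc (Suc (i div 2))"
  have 1: "mix (case_nat x (\<lambda>_. y)) c = (\<lambda>i. case_nat x (case_nat y c) (?r i))" for x y
    by (auto simp: fun_eq_iff mix_def elim!: evenE split: nat.split)
  have "P x y \<longleftrightarrow> P (case_nat x (\<lambda>_. y) 0) (case_nat x (\<lambda>_. y) 1)" for x y by simp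
  then show ?thesis unfolding definable2_def
    by (intro exI[of _ "ren ?r p"] exI[of _ c]) (simp only: sat_ren 1[symmetric] p[symmetric] simp_thms)
qed

section \<open>Sets of the ground model\<close>

locale zf =
  fixes E :: "'m \<Rightarrow> 'm \<Rightarrow> bool"
  assumes model: "model_ZF E"
begin

section \<open>The axioms of ZF in usable form\<close>

lemma ext: "(\<And>z. E z x \<longleftrightarrow> E z y) \<Longrightarrow> x = y"
proof -
  have "\<forall>x y. (\<forall>z. E z x \<longleftrightarrow> E z y) \<longrightarrow> x = y"
    using model unfolding model_ZF_def by (elim conjE)
  then show "(\<And>z. E z x \<longleftrightarrow> E z y) \<Longrightarrow> x = y" by simp
qed

lemma regularity: "E y x \<Longrightarrow> \<exists>y. E y x \<and> (\<forall>z. E z x \<longrightarrow> \<not> E z y)"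
proof -
  have "\<forall>x. (\<exists>y. E y x) \<longrightarrow> (\<exists>y. E y x \<and> \<not> (\<exists>z. E z x \<and> E z y))"
    using model unfolding model_ZF_def by (elim conjE)
  then show "E y x \<Longrightarrow> \<exists>y. E y x \<and> (\<forall>z. E z x \<longrightarrow> \<not> E z y)" by blast
qed

lemma ex_pair: "\<exists>u. \<forall>z. E z u \<longleftrightarrow> z = x \<or> z = y"
proof -
  have "\<forall>x y. \<exists>u. \<forall>z. E z u \<longleftrightarrow> z = x \<or> z = y"
    using model unfolding model_ZF_def by (elim conjE)
  then show ?thesis by simp
qed

lemma ex_Union: "\<exists>u. \<forall>z. E z u \<longleftrightarrow> (\<exists>y. E y x \<and> E z y)"
proof -
  have "\<forall>x. \<exists>u. \<forall>z. E z u \<longleftrightarrow> (\<exists>y. E y x \<and> E z y)"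
    using model unfolding model_ZF_def by (elim conjE)
  then show ?thesis by simp
qed

lemma ex_Pow: "\<exists>u. \<forall>z. E z u \<longleftrightarrow> (\<forall>y. E y z \<longrightarrow> E y x)"
proof -
  have "\<forall>x. \<exists>u. \<forall>z. E z u \<longleftrightarrow> (\<forall>y. E y z \<longrightarrow> E y x)"
    using model unfolding model_ZF_def by (elim conjE)
  then show ?thesis by simp
qed

lemma ex_empty: "\<exists>u. \<forall>z. \<not> E z u"
proof -
  have "\<exists>w. (\<exists>e. E e w \<and> (\<forall>z. \<not> E z e)) \<and>
      (\<forall>x. E x w \<longrightarrow> (\<exists>y. E y w \<and> (\<forall>z. E z y \<longleftrightarrow> E z x \<or> z = x)))"
    using model unfolding model_ZF_def by (elim conjE)
  then show ?thesis by blast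
qed

lemma separation:
  assumes "dp E (\<lambda>s. P (s 0))" shows "\<exists>u. \<forall>z. E z u \<longleftrightarrow> E z x \<and> P z"
proof -
  have "\<forall>P. definable1 E P \<longrightarrow> (\<forall>x. \<exists>u. \<forall>z. E z u \<longleftrightarrow> E z x \<and> P z)"
    using model unfolding model_ZF_def by (elim conjE)
  with dp_definable1[OF assms] show ?thesis by simp
qed

text \<open>The axiom asks for a relation that is total on the given set, so separation first cuts
  \<open>x\<close> down to the points where \<open>R\<close> has a value.\<close>

lemma replacement:
  assumes R: "dp E (\<lambda>s. R (s 0) (s 1))" and fn: "\<And>y z z'. E y x \<Longrightarrow> R y z \<Longrightarrow> R y z' \<Longrightarrow> z = z'"
  shows "\<exists>u. \<forall>z. E z u \<longleftrightarrow> (\<exists>y. E y x \<and> R y z)"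
proof -
  have "dp E (\<lambda>s. \<exists>z. R (s 0) z)"
    by (rule dp_ex, rule dp_ren[OF R, of "case_nat 1 (\<lambda>_. 0)", simplified])
  from separation[OF this] obtain x' where x': "\<And>z. E z x' \<longleftrightarrow> E z x \<and> (\<exists>w. R z w)" by blast
  have "\<forall>y. E y x' \<longrightarrow> (\<exists>!z. R y z)" using x' fn by blast
  moreover have "\<forall>R. definable2 E R \<longrightarrow> (\<forall>x. (\<forall>y. E y x \<longrightarrow> (\<exists>!z. R y z)) \<longrightarrow>
      (\<exists>u. \<forall>z. E z u \<longleftrightarrow> (\<exists>y. E y x \<and> R y z)))"
    using model unfolding model_ZF_def by (elim conjE)
  ultimately obtain u where "\<forall>z. E z u \<longleftrightarrow> (\<exists>y. E y x' \<and> R y z)"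
    using dp_definable2[OF R] by presburger
  then show ?thesis using x' by blast
qed

lemma minimal:
  assumes "dp E (\<lambda>s. P (s 0))" "E y x" "P y"
  obtains y where "E y x" "P y" "\<And>z. E z x \<Longrightarrow> E z y \<Longrightarrow> \<not> P z"
proof -
  obtain u where u: "\<And>z. E z u \<longleftrightarrow> E z x \<and> P z" using separation[OF assms(1)] by blast
  then have "E y u" using assms by blast
  from regularity[OF this] show ?thesis using u that by blast
qed

lemma not_mem_cycle: "\<not> (E x y \<and> E y x)"
proof
  assume *: "E x y \<and> E y x"
  obtain u where u: "\<And>z. E z u \<longleftrightarrow> z = x \<or> z = y" using ex_pair by blast
  then have "E x u" by simp
  from regularity[OF this] obtain w where "E w u" "\<And>z. E z u \<Longrightarrow> \<not> E z w" by blast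
  then show False using u[of w] u[of x] u[of y] * by auto
qed

lemma mem_irrefl: "\<not> E x x"
  using not_mem_cycle[of x x] by blast

section \<open>Pairs, products and function values\<close>

lemma setof_iff:
  assumes "\<exists>a. \<forall>x. E x a \<longleftrightarrow> P x" shows "E x (setof E P) \<longleftrightarrow> P x"
proof -
  from assms obtain a where a: "\<forall>x. E x a \<longleftrightarrow> P x" by blast
  then have "\<forall>x. E x (setof E P) \<longleftrightarrow> P x"
    unfolding setof_def
  proof (rule theI)
    fix b assume "\<forall>x. E x b \<longleftrightarrow> P x"
    with a show "b = a" by (intro ext) simp
  qed
  then show ?thesis by blast
qed

lemma mem_upair: "E z (upair E x y) \<longleftrightarrow> z = x \<or> z = y"
  unfolding upair_def by (rule setof_iff) (rule ex_pair)

lemma upair_eq_iff: "upair E x y = upair E x' y' \<longleftrightarrow> x = x' \<and> y = y' \<or> x = y' \<and> y = x'"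
proof
  assume "upair E x y = upair E x' y'"
  then have *: "z = x \<or> z = y \<longleftrightarrow> z = x' \<or> z = y'" for z
    using mem_upair[of z x y] mem_upair[of z x' y'] by simp
  show "x = x' \<and> y = y' \<or> x = y' \<and> y = x'"
    using *[of x] *[of y] *[of x'] *[of y'] by auto
next
  assume "x = x' \<and> y = y' \<or> x = y' \<and> y = x'"
  then show "upair E x y = upair E x' y'" by (auto intro!: ext simp: mem_upair)
qed

lemma opair_eq_iff [simp]: "opair E x y = opair E x' y' \<longleftrightarrow> x = x' \<and> y = y'"
  unfolding opair_def upair_eq_iff by auto

lemma mem_zero [simp]: "\<not> E x (zero E)"
  unfolding zero_def using setof_iff[of "\<lambda>_. False" x] ex_empty by simp

lemma mem_one: "E x (one E) \<longleftrightarrow> x = zero E"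
  unfolding one_def succ_def using setof_iff[of "\<lambda>z. E z (zero E) \<or> z = zero E"] ex_pair[of "zero E" "zero E"]
  by simp

lemma zero_neq_one [simp]: "zero E \<noteq> one E" "one E \<noteq> zero E"
proof -
  show "zero E \<noteq> one E"
  proof
    assume "zero E = one E"
    then show False using mem_one[of "zero E"] mem_zero[of "zero E"] by simp
  qed
  then show "one E \<noteq> zero E" by simp
qed

lemma dp_upair: "dp E (\<lambda>s. s i = upair E (s j) (s k))"
proof -
  have "p = upair E x y \<longleftrightarrow> (\<forall>z. E z p \<longleftrightarrow> z = x \<or> z = y)" for p x y
  proof
    assume "\<forall>z. E z p \<longleftrightarrow> z = x \<or> z = y"
    then show "p = upair E x y" by (intro ext) (simp add: mem_upair)
  qed (simp add: mem_upair)
  then have eq: "(\<lambda>s. s i = upair E (s j) (s k)) = (\<lambda>s. \<forall>z. E z (s i) \<longleftrightarrow> z = s j \<or> z = s k)"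
    by (intro HOL.ext) blast
  show ?thesis unfolding eq by (intro dp_intros)
qed

lemma df_upair: "df E f \<Longrightarrow> df E g \<Longrightarrow> df E (\<lambda>s. upair E (f s) (g s))"
  by (rule df2[of E "upair E", OF dp_upair])

lemma df_opair: "df E f \<Longrightarrow> df E g \<Longrightarrow> df E (\<lambda>s. opair E (f s) (g s))"
  unfolding opair_def by (intro df_upair)

lemma mem_times: "E p (times E a b) \<longleftrightarrow> (\<exists>x y. E x a \<and> E y b \<and> p = opair E x y)"
  unfolding times_def
proof (rule setof_iff)
  \<comment> \<open>A pair from \<open>a\<close> and \<open>b\<close> is a set of subsets of their
    union \<open>v\<close>, so the product is separated from the second power set
    \<open>q\<close>.\<close>
  obtain u where u: "\<And>z. E z u \<longleftrightarrow> z = a \<or> z = b" using ex_pair by blast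
  obtain v where v: "\<And>z. E z v \<longleftrightarrow> (\<exists>y. E y u \<and> E z y)" using ex_Union by blast
  obtain w where w: "\<And>z. E z w \<longleftrightarrow> (\<forall>y. E y z \<longrightarrow> E y v)" using ex_Pow by blast
  obtain q where q: "\<And>z. E z q \<longleftrightarrow> (\<forall>y. E y z \<longrightarrow> E y w)" using ex_Pow by blast
  have "dp E (\<lambda>s. \<exists>x y. E x a \<and> E y b \<and> s 0 = opair E x y)"
    by (intro dp_intros df_opair)
  from separation[OF this, of q] obtain c where
    c: "\<And>z. E z c \<longleftrightarrow> E z q \<and> (\<exists>x y. E x a \<and> E y b \<and> z = opair E x y)" by blast
  have "E (opair E x y) q" if "E x a" "E y b" for x y
    using that unfolding q w v u opair_def mem_upair by (auto simp: mem_upair)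
  then show "\<exists>c. \<forall>p. E p c \<longleftrightarrow> (\<exists>x y. E x a \<and> E y b \<and> p = opair E x y)" using c by (intro exI[of _ c]) auto
qed

lemma val_unique:
  assumes "maps E f a b" "E x a" shows "E (opair E x y) f \<longleftrightarrow> y = val E f x"
proof -
  from assms have ex1: "\<exists>!y. E (opair E x y) f" unfolding maps_def by blast
  then have "E (opair E x (val E f x)) f" unfolding val_def by (rule theI')
  with ex1 show ?thesis by blast
qed

lemma val_mem:
  assumes "maps E f a b" "E x a" shows "E (val E f x) b"
proof -
  have "E (opair E x (val E f x)) f" using val_unique[OF assms] by blast
  then show ?thesis using assms(1) unfolding maps_def by (metis opair_eq_iff)
qed


section \<open>Transitive closures\<close>

lemma below_mem: "E y x \<Longrightarrow> below E y x"
  unfolding below_def subset_def by blast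

lemma below_trans_mem: "below E y x \<Longrightarrow> E z y \<Longrightarrow> below E z x"
  unfolding below_def transitive_def subset_def by blast

lemma dp_below: "df E f \<Longrightarrow> df E g \<Longrightarrow> dp E (\<lambda>s. below E (f s) (g s))"
proof (rule dp2)
  show "dp E (\<lambda>s. below E (s 0) (s 1))"
    unfolding below_def transitive_def subset_def by (intro dp_intros)
qed

end

text \<open>The stage of the constructible hierarchy in which x appears is transitive by the very form
  of the recursion, so no recursion over the natural numbers of M is needed for transitive closures.\<close>

locale zfl = zf +
  assumes V_eq_L: "V_eq_L E"
begin

lemma ex_transitive: obtains t where "transitive E t" "E x t"
proof -
  from V_eq_L obtain \<alpha> f b where ord: "ordinal E \<alpha>"
    and rec: "\<And>\<beta> z. E \<beta> (succ E \<alpha>) \<Longrightarrow>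
        E z (val E f \<beta>) \<longleftrightarrow> (\<exists>\<gamma>. E \<gamma> \<beta> \<and> def_subset E (val E f \<gamma>) z)"
    and x: "E x (val E f \<alpha>)"
    unfolding V_eq_L_def constructible_def by meson
  obtain u where u: "\<And>z. E z u \<longleftrightarrow> z = \<alpha> \<or> z = \<alpha>" using ex_pair by blast
  obtain v where v: "\<And>z. E z v \<longleftrightarrow> z = \<alpha> \<or> z = u" using ex_pair by blast
  obtain w where w: "\<And>z. E z w \<longleftrightarrow> (\<exists>y. E y v \<and> E z y)" using ex_Union by blast
  have succ: "E z (succ E \<alpha>) \<longleftrightarrow> E z \<alpha> \<or> z = \<alpha>" for z
    unfolding succ_def by (rule setof_iff, rule exI[of _ w]) (auto simp: u v w)
  \<comment> \<open>A definable subset of a stage has its members in that stage. So \<open>z\<close>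
    lies in an earlier stage and is in turn a definable subset of a still earlier one.\<close>
  have step: "E z (val E f \<gamma>)" if "def_subset E (val E f \<gamma>) y" "E z y" for \<gamma> y z
    using that unfolding def_subset_def by meson
  have "transitive E (val E f \<alpha>)"
    unfolding transitive_def subset_def
  proof (intro allI impI)
    fix y z assume "E y (val E f \<alpha>)" "E z y"
    then obtain \<gamma> where \<gamma>: "E \<gamma> \<alpha>" "def_subset E (val E f \<gamma>) y"
      using rec[of \<alpha> y] succ[of \<alpha>] by auto
    then have "E z (val E f \<gamma>)" using step[of \<gamma> y z] \<open>E z y\<close> by simp
    then obtain \<delta> where \<delta>: "E \<delta> \<gamma>" "def_subset E (val E f \<delta>) z"
      using rec[of \<gamma> z] succ[of \<gamma>] \<gamma> by auto
    moreover have "E \<delta> \<alpha>" using ord \<gamma> \<delta> unfolding ordinal_def transitive_def subset_def by blast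
    ultimately show "E z (val E f \<alpha>)" using rec[of \<alpha> z] succ[of \<alpha>] by auto
  qed
  with x show ?thesis using that by simp
qed

text \<open>Within a transitive set containing \<open>v\<close>, the elements satisfying the
  conclusion form a transitive set that includes \<open>v\<close>, hence also
  \<open>Cl(v)\<close>.\<close>

lemma below_cases:
  assumes "below E w v" shows "E w v \<or> (\<exists>v'. E v' v \<and> below E w v')"
proof -
  obtain t where t: "transitive E t" "E v t" by (rule ex_transitive)
  have "dp E (\<lambda>s. E (s 0) v \<or> (\<exists>v'. E v' v \<and> below E (s 0) v'))"
    by (intro dp_intros dp_below)
  from separation[OF this, of t] obtain u where
    u: "\<And>z. E z u \<longleftrightarrow> E z t \<and> (E z v \<or> (\<exists>v'. E v' v \<and> below E z v'))" by blast
  have "transitive E u" unfolding transitive_def subset_def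
  proof (intro allI impI)
    fix y z assume *: "E y u" "E z y"
    then have "E z t" using t u unfolding transitive_def subset_def by blast
    moreover have "\<exists>v'. E v' v \<and> below E z v'"
      using * u below_mem below_trans_mem by blast
    ultimately show "E z u" using u by blast
  qed
  moreover have "subset E v u" using t u unfolding subset_def transitive_def by blast
  ultimately have "E w u" using assms unfolding below_def by blast
  then show ?thesis using u by blast
qed

text \<open>Foundation is applied to the property that \<open>v\<close> or something below
  \<open>v\<close> fails \<open>P\<close>. At a minimal such \<open>v\<close> the induction step
  gives a failure below \<open>v\<close>, which \<open>below_cases\<close> traces to a member of
  \<open>v\<close>.\<close>

lemma below_induct:
  assumes P: "dp E (\<lambda>s. P (s 0))" and step: "\<And>u. (\<And>u'. below E u' u \<Longrightarrow> P u') \<Longrightarrow> P u"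
  shows "P u"
proof (rule ccontr)
  assume "\<not> P u"
  obtain t where t: "transitive E t" "E u t" by (rule ex_transitive)
  have "dp E (\<lambda>s. \<exists>w. (w = s 0 \<or> below E w (s 0)) \<and> \<not> P w)"
    by (intro dp_intros dp_below dp1[where P = P, OF P])
  from minimal[OF this t(2)] \<open>\<not> P u\<close> obtain v where v: "E v t"
    "\<exists>w. (w = v \<or> below E w v) \<and> \<not> P w"
    and min: "\<And>z. E z t \<Longrightarrow> E z v \<Longrightarrow> \<not> (\<exists>w. (w = z \<or> below E w z) \<and> \<not> P w)" by blast
  from v step obtain w where w: "below E w v" "\<not> P w" by blast
  from below_cases[OF w(1)] obtain v' where "E v' v" "w = v' \<or> below E w v'" by blast
  then show False using min[of v'] w(2) v(1) t(1) unfolding transitive_def subset_def by blast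
qed

end

context zf begin

section \<open>Ordinals of the ground model\<close>

lemma ordinal_mem: "ordinal E x \<Longrightarrow> E y x \<Longrightarrow> ordinal E y"
  unfolding ordinal_def transitive_def subset_def by meson

lemma ordinal_trans: "ordinal E x \<Longrightarrow> E y x \<Longrightarrow> E z y \<Longrightarrow> E z x"
  unfolding ordinal_def transitive_def subset_def by meson

lemma dp_ordinal: "df E f \<Longrightarrow> dp E (\<lambda>s. ordinal E (f s))"
proof (rule dp1)
  show "dp E (\<lambda>s. ordinal E (s 0))"
    unfolding ordinal_def transitive_def subset_def by (intro dp_intros)
qed

text \<open>The Burali-Forti argument: otherwise the ordinals would form an ordinal that is a member
  of itself.\<close>

lemma ordinals_not_bounded: "\<exists>x. ordinal E x \<and> \<not> E x u"
proof (rule ccontr)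
  assume "\<nexists>x. ordinal E x \<and> \<not> E x u"
  then have all: "ordinal E x \<Longrightarrow> E x u" for x by blast
  have "dp E (\<lambda>s. ordinal E (s 0))" by (intro dp_ordinal df_var)
  from separation[OF this, of u] obtain w where "\<And>z. E z w \<longleftrightarrow> E z u \<and> ordinal E z" by blast
  then have w: "E z w \<longleftrightarrow> ordinal E z" for z using all by blast
  have "ordinal E w"
    unfolding ordinal_def transitive_def subset_def w
    using ordinal_mem ordinal_trans by blast
  then show False using w mem_irrefl by blast
qed

text \<open>Linearity comes from foundation: a minimal \<open>x\<close> with an incomparable partner
  and a minimal such partner \<open>x'\<close> have the same members.\<close>

lemma ordinal_linear:
  assumes k: "ordinal E k" and "E y k" "E y' k"
  shows "y = y' \<or> E y y' \<or> E y' y"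
proof (rule ccontr)
  let ?I = "\<lambda>y y'. \<not> (y = y' \<or> E y y' \<or> E y' y)"
  assume "?I y y'"
  with assms(3) have ex: "\<exists>y'. E y' k \<and> ?I y y'" by (intro exI conjI)
  have "dp E (\<lambda>s. \<exists>y'. E y' k \<and> ?I (s 0) y')" by (intro dp_intros)
  then obtain x where x: "E x k" "\<exists>y'. E y' k \<and> ?I x y'"
    and minx: "\<And>z. E z k \<Longrightarrow> E z x \<Longrightarrow> \<not> (\<exists>y'. E y' k \<and> ?I z y')"
    by (rule minimal[where P = "\<lambda>z. \<exists>y'. E y' k \<and> ?I z y'", OF _ assms(2) ex]) (rule that; simp)
  from x(2) obtain v where v: "E v k" "?I x v" by (elim exE conjE)
  have "dp E (\<lambda>s. ?I x (s 0))" by (intro dp_intros)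
  then obtain x' where x': "E x' k" "?I x x'"
    and minx': "\<And>z. E z k \<Longrightarrow> E z x' \<Longrightarrow> \<not> ?I x z"
    by (rule minimal[where P = "?I x", OF _ v]) (rule that; simp)
  have "E z x'" if z: "E z x" for z
  proof -
    have "z = x' \<or> E z x' \<or> E x' z"
      using minx[OF ordinal_trans[OF k x(1) z] z] x'(1) by auto
    moreover have "E x' z \<Longrightarrow> E x' x" by (rule ordinal_trans[OF ordinal_mem[OF k x(1)] z])
    ultimately show ?thesis using x'(2) z by auto
  qed
  moreover have "E z x" if z: "E z x'" for z
  proof -
    have "z = x \<or> E z x \<or> E x z"
      using minx'[OF ordinal_trans[OF k x'(1) z] z] by auto
    moreover have "E x z \<Longrightarrow> E x x'" by (rule ordinal_trans[OF ordinal_mem[OF k x'(1)] z])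
    ultimately show ?thesis using x'(2) z by auto
  qed
  ultimately have "x = x'" by (intro ext) blast
  with x' show False by blast
qed

text \<open>A partial surjection: \<open>f\<close> need not be total on \<open>d\<close>, and its
  values outside \<open>k\<close> are ignored.\<close>

definition onto :: "'m \<Rightarrow> 'm \<Rightarrow> 'm \<Rightarrow> bool" where
  "onto d f k \<longleftrightarrow> (\<forall>y. E y k \<longrightarrow> (\<exists>a. E a d \<and> E (opair E a y) f)) \<and>
    (\<forall>a y y'. E y k \<and> E y' k \<and> E (opair E a y) f \<and> E (opair E a y') f \<longrightarrow> y = y')"

text \<open>\<open>w\<close> is the order of \<open>k\<close> pulled back along \<open>f\<close>; it
  codes the ordinal by pairs from \<open>d\<close>.\<close>

definition preorder_of :: "'m \<Rightarrow> 'm \<Rightarrow> 'm \<Rightarrow> 'm \<Rightarrow> bool" where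
  "preorder_of d f k w \<longleftrightarrow> (\<forall>a b. E (opair E a b) w \<longleftrightarrow> E a d \<and> E b d \<and>
    (\<exists>y z. E y k \<and> E z k \<and> E (opair E a y) f \<and> E (opair E b z) f \<and> (E y z \<or> y = z)))"

text \<open>At the least value \<open>x\<close> of \<open>f\<close> that \<open>f'\<close> does not
  match, all smaller values are shared, and comparison through \<open>w\<close> shows that the value
  \<open>x'\<close> of \<open>f'\<close> at \<open>c\<close> has the same members as
  \<open>x\<close>.\<close>

lemma preorder_determines_values:
  assumes k: "ordinal E k" "onto d f k" "preorder_of d f k w"
    and k': "ordinal E k'" "onto d f' k'" "preorder_of d f' k' w"
    and a: "E a d" "E y k" "E (opair E a y) f"
  shows "E y k' \<and> E (opair E a y) f'"
proof (rule ccontr)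
  let ?P = "\<lambda>y. \<exists>a. E a d \<and> E (opair E a y) f \<and> \<not> (E y k' \<and> E (opair E a y) f')"
  assume "\<not> (E y k' \<and> E (opair E a y) f')"
  then have ex: "?P y" using a by blast
  have "dp E (\<lambda>s. ?P (s 0))" by (intro dp_intros df_opair)
  then obtain x where x: "E x k" "?P x" and min: "\<And>z. E z k \<Longrightarrow> E z x \<Longrightarrow> \<not> ?P z"
    by (rule minimal[where P = ?P, OF _ a(2) ex]) (rule that; simp)
  from x obtain c where c: "E c d" "E (opair E c x) f" "\<not> (E x k' \<and> E (opair E c x) f')" by blast
  have w: "E (opair E a b) w \<longleftrightarrow> E a d \<and> E b d \<and>
    (\<exists>y z. E y k \<and> E z k \<and> E (opair E a y) f \<and> E (opair E b z) f \<and> (E y z \<or> y = z))" for a b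
    using k(3) unfolding preorder_of_def by blast
  have w': "E (opair E a b) w \<longleftrightarrow> E a d \<and> E b d \<and>
    (\<exists>y z. E y k' \<and> E z k' \<and> E (opair E a y) f' \<and> E (opair E b z) f' \<and> (E y z \<or> y = z))" for a b
    using k'(3) unfolding preorder_of_def by blast
  have fn: "E y k \<Longrightarrow> E z k \<Longrightarrow> E (opair E a y) f \<Longrightarrow> E (opair E a z) f \<Longrightarrow> y = z" for a y z
    using k(2) unfolding onto_def by blast
  have fn': "E y k' \<Longrightarrow> E z k' \<Longrightarrow> E (opair E a y) f' \<Longrightarrow> E (opair E a z) f' \<Longrightarrow> y = z" for a y z
    using k'(2) unfolding onto_def by blast
  have "E (opair E c c) w" using w c x by blast
  then obtain x' where x': "E x' k'" "E (opair E c x') f'" using w' by blast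
  have "E z x'" if z: "E z x" for z
  proof -
    have zk: "E z k" using ordinal_trans[OF k(1) x(1) z] .
    then obtain b where b: "E b d" "E (opair E b z) f" using k(2) unfolding onto_def by blast
    then have bz: "E z k'" "E (opair E b z) f'" using min[OF zk z] by blast+
    have "E (opair E b c) w" unfolding w using b c x zk z by blast
    then have "E z x' \<or> z = x'" unfolding w' using fn' bz x' by blast
    moreover have "z \<noteq> x'"
    proof
      assume "z = x'"
      then have "E (opair E c b) w" unfolding w' using b c x' bz by blast
      then have "E x z \<or> x = z" unfolding w using fn x c b zk by blast
      then show False using z not_mem_cycle mem_irrefl by blast
    qed
    ultimately show ?thesis by blast
  qed
  moreover have "E z x" if z: "E z x'" for z
  proof -
    have zk: "E z k'" using ordinal_trans[OF k'(1) x'(1) z] .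
    then obtain b where b: "E b d" "E (opair E b z) f'" using k'(2) unfolding onto_def by blast
    have "E (opair E b c) w" unfolding w' using b c x' zk z by blast
    then obtain u where u: "E u k" "E (opair E b u) f" "E u x \<or> u = x" unfolding w using fn c x by blast
    have "u \<noteq> x"
    proof
      assume "u = x"
      then have "E (opair E c b) w" unfolding w using b c x u by blast
      then have "E x' z \<or> x' = z" unfolding w' using fn' x' b zk by blast
      then show False using z not_mem_cycle mem_irrefl by blast
    qed
    then have "E u x" using u by blast
    then have "E u k'" "E (opair E b u) f'" using min[OF u(1)] b u by blast+
    then have "u = z" using fn' b zk by blast
    then show ?thesis using \<open>E u x\<close> by blast
  qed
  ultimately have "x = x'" by (intro ext) blast
  with c x' show False by blast
qed

text \<open>Lindenbaum's theorem, a form of Hartogs' theorem with surjections that needs no choice.\<close>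

lemma ex_ordinal_not_onto: obtains k where "ordinal E k" "\<And>f. \<not> onto d f k"
proof -
  let ?R = "\<lambda>w k. ordinal E k \<and> (\<exists>f. onto d f k \<and> preorder_of d f k w)"
  obtain q where q: "\<And>z. E z q \<longleftrightarrow> (\<forall>y. E y z \<longrightarrow> E y (times E d d))" using ex_Pow by meson
  have R: "dp E (\<lambda>s. ?R (s 0) (s 1))"
    unfolding onto_def preorder_of_def by (intro dp_intros df_opair dp_ordinal)
  \<comment> \<open>Equal preorders give equal ordinals, so replacement collects all ordinals coded
    by subsets of \<open>d \<times> d\<close> into a set; an ordinal outside it is not an image of
    \<open>d\<close>.\<close>
  have fn: "k = k'" if "?R w k" "?R w k'" for w k k'
  proof -
    have "E y k'" if *: "?R w k" "?R w k'" "E y k" for k k' y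
    proof -
      from * obtain f f' where f: "ordinal E k" "onto d f k" "preorder_of d f k w"
        "ordinal E k'" "onto d f' k'" "preorder_of d f' k' w" by blast
      then obtain a where "E a d" "E (opair E a y) f" using * unfolding onto_def by blast
      then show ?thesis using preorder_determines_values[OF f] * by blast
    qed
    from this[of k k'] this[of k' k] that show ?thesis by (intro ext) blast
  qed
  from replacement[OF R, of q] fn obtain u where
    u: "\<And>z. E z u \<longleftrightarrow> (\<exists>w. E w q \<and> ?R w z)" by metis
  obtain k where k: "ordinal E k" "\<not> E k u" using ordinals_not_bounded by blast
  have "\<not> onto d f k" for f
  proof
    assume f: "onto d f k"
    have "dp E (\<lambda>s. \<exists>a b y z. s 0 = opair E a b \<and> E y k \<and> E z k \<and> E (opair E a y) f \<and>
        E (opair E b z) f \<and> (E y z \<or> y = z))" by (intro dp_intros df_opair)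
    from separation[OF this, of "times E d d"] obtain w where
      w: "\<And>p. E p w \<longleftrightarrow> E p (times E d d) \<and> (\<exists>a b y z. p = opair E a b \<and> E y k \<and> E z k \<and>
        E (opair E a y) f \<and> E (opair E b z) f \<and> (E y z \<or> y = z))" by blast
    have "preorder_of d f k w" unfolding preorder_of_def w mem_times by simp
    moreover have "E w q" unfolding q w by simp
    ultimately show False using k f u by blast
  qed
  with k that show ?thesis by blast
qed

end

section \<open>Combinatory terms and bracket abstraction\<close>

datatype comb = KB | KC | KI | KK | KW | KCC

datatype tm = V nat | Co comb | Ap tm tm (infixl "\<sqdot>" 200)

text \<open>\<open>arg_lam x u k\<close> is a term that, against \<open>\<xi>\<cdot>\<pi>\<close>, runs k against \<open>u[\<xi>/x]\<cdot>\<xi>\<cdot>\<pi>\<close>. Building the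
  argument on the stack in this way makes the abstraction exact: no delayed substitution is left
  in argument position.\<close>

primrec arg_lam :: "nat \<Rightarrow> tm \<Rightarrow> tm \<Rightarrow> tm" where
  "arg_lam x (V y) k = (if x = y then Co KW \<sqdot> k else Co KC \<sqdot> (Co KC \<sqdot> k) \<sqdot> V y)"
| "arg_lam x (Co c) k = Co KC \<sqdot> (Co KC \<sqdot> k) \<sqdot> Co c"
| "arg_lam x (u \<sqdot> v) k = arg_lam x v (Co KC \<sqdot> arg_lam x u (Co KB \<sqdot> Co KC \<sqdot> (Co KB \<sqdot> k)))"

text \<open>For an application, \<open>arg_lam\<close> puts the instance of \<open>u\<close> in
  front of \<xi>, and \<open>KC\<close> swaps the two before \<open>lam x t\<close> consumes
  \<xi>.\<close>

primrec lam :: "nat \<Rightarrow> tm \<Rightarrow> tm" where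
  "lam x (V y) = (if x = y then Co KI else Co KK \<sqdot> V y)"
| "lam x (Co c) = Co KK \<sqdot> Co c"
| "lam x (t \<sqdot> u) = arg_lam x u (Co KC \<sqdot> lam x t)"

locale ralg = zf E for E :: "'m \<Rightarrow> 'm \<Rightarrow> bool" +
  fixes A :: "'m realg"
  assumes ralg: "realizability_algebra E A"
begin

abbreviation T where "T \<xi> \<equiv> E \<xi> (terms A)"
abbreviation S where "S \<pi> \<equiv> E \<pi> (stacks A)"
abbreviation pl where "pl \<xi> \<pi> \<equiv> E (star E A \<xi> \<pi>) (pole A)"
abbreviation rl (infix "\<Vdash>" 50) where "\<xi> \<Vdash> F \<equiv> realizes E A \<xi> F"

lemma maps_funs:
  "maps E (app_fun A) (times E (terms A) (terms A)) (terms A)"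
  "maps E (push_fun A) (times E (terms A) (stacks A)) (stacks A)"
  "maps E (star_fun A) (times E (terms A) (stacks A)) (procs A)"
  "maps E (cont_fun A) (stacks A) (terms A)"
  using ralg unfolding realizability_algebra_def by - (elim conjE; assumption)+

lemma app_T: "T \<xi> \<Longrightarrow> T \<eta> \<Longrightarrow> T (app E A \<xi> \<eta>)"
  unfolding app_def by (rule val_mem[OF maps_funs(1)]) (simp add: mem_times)

lemma push_S: "T \<xi> \<Longrightarrow> S \<pi> \<Longrightarrow> S (push E A \<xi> \<pi>)"
  unfolding push_def by (rule val_mem[OF maps_funs(2)]) (simp add: mem_times)

lemma cont_T: "S \<pi> \<Longrightarrow> T (cont E A \<pi>)"
  unfolding cont_def by (rule val_mem[OF maps_funs(4)])

lemma push_graph: "T \<xi> \<Longrightarrow> S \<pi> \<Longrightarrow> E (opair E (opair E \<xi> \<pi>) \<rho>) (push_fun A) \<longleftrightarrow> \<rho> = push E A \<xi> \<pi>"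
  unfolding push_def by (rule val_unique[OF maps_funs(2)]) (simp add: mem_times)

lemma star_graph: "T \<xi> \<Longrightarrow> S \<pi> \<Longrightarrow> E (opair E (opair E \<xi> \<pi>) p) (star_fun A) \<longleftrightarrow> p = star E A \<xi> \<pi>"
  unfolding star_def by (rule val_unique[OF maps_funs(3)]) (simp add: mem_times)

lemma QP_T: "E \<xi> (QP A) \<Longrightarrow> T \<xi>"
proof -
  have "subset E (QP A) (terms A)" using ralg unfolding realizability_algebra_def by (elim conjE)
  then show "E \<xi> (QP A) \<Longrightarrow> T \<xi>" unfolding subset_def by simp
qed

lemma QP_app: "E \<xi> (QP A) \<Longrightarrow> E \<eta> (QP A) \<Longrightarrow> E (app E A \<xi> \<eta>) (QP A)"
proof -
  have "\<forall>\<xi> \<eta>. E \<xi> (QP A) \<and> E \<eta> (QP A) \<longrightarrow> E (app E A \<xi> \<eta>) (QP A)"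
    using ralg unfolding realizability_algebra_def by (elim conjE)
  then show "E \<xi> (QP A) \<Longrightarrow> E \<eta> (QP A) \<Longrightarrow> E (app E A \<xi> \<eta>) (QP A)" by simp
qed

primrec const :: "comb \<Rightarrow> 'm" where
  "const KB = cB A" | "const KC = cC A" | "const KI = cI A"
| "const KK = cK A" | "const KW = cW A" | "const KCC = cc A"

lemma const_QP: "E (const c) (QP A)"
proof -
  have "\<forall>\<xi> \<in> {cB A, cC A, cI A, cK A, cW A, cc A}. E \<xi> (QP A)"
    using ralg unfolding realizability_algebra_def by (elim conjE)
  then show ?thesis by (cases c) simp_all
qed

lemma pole_exec: "exec E A p q \<Longrightarrow> E q (pole A) \<Longrightarrow> E p (pole A)"
proof -
  have "\<forall>p q. exec E A p q \<and> E q (pole A) \<longrightarrow> E p (pole A)"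
    using ralg unfolding realizability_algebra_def by (elim conjE)
  then show "exec E A p q \<Longrightarrow> E q (pole A) \<Longrightarrow> E p (pole A)" by blast
qed

lemmas pole_app = pole_exec[OF exec.app] and pole_B = pole_exec[OF exec.B]
  and pole_C = pole_exec[OF exec.C] and pole_I = pole_exec[OF exec.I]
  and pole_K = pole_exec[OF exec.K] and pole_W = pole_exec[OF exec.W]
  and pole_cc = pole_exec[OF exec.cc] and pole_cont = pole_exec[OF exec.cont]

lemma const_T: "T (const c)"
  by (rule QP_T[OF const_QP])

lemmas consts_T = const_T[of KB, simplified] const_T[of KC, simplified] const_T[of KI, simplified]
  const_T[of KK, simplified] const_T[of KW, simplified] const_T[of KCC, simplified]

primrec ev :: "(nat \<Rightarrow> 'm) \<Rightarrow> tm \<Rightarrow> 'm" where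
  "ev \<rho> (V i) = \<rho> i"
| "ev \<rho> (Co c) = const c"
| "ev \<rho> (t \<sqdot> u) = app E A (ev \<rho> t) (ev \<rho> u)"

definition env :: "(nat \<Rightarrow> 'm) \<Rightarrow> bool" where
  "env \<rho> \<longleftrightarrow> (\<forall>i. T (\<rho> i))"

lemma env_upd [simp]: "env \<rho> \<Longrightarrow> T \<xi> \<Longrightarrow> env (\<rho>(x := \<xi>))"
  by (simp add: env_def)

lemma ev_T [simp]: "env \<rho> \<Longrightarrow> T (ev \<rho> t)"
  by (induction t) (auto simp: env_def app_T const_T)

lemma ev_QP: "(\<And>i. E (\<rho> i) (QP A)) \<Longrightarrow> E (ev \<rho> t) (QP A)"
  by (induction t) (auto simp: QP_app const_QP)

lemmas T_intros = app_T push_S cont_T consts_T ev_T env_upd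

text \<open>The pole is closed under anti-reduction only, so applications are unwound before they are run.\<close>

primrec run :: "(nat \<Rightarrow> 'm) \<Rightarrow> tm \<Rightarrow> 'm \<Rightarrow> bool" where
  "run \<rho> (V i) \<pi> \<longleftrightarrow> pl (\<rho> i) \<pi>"
| "run \<rho> (Co c) \<pi> \<longleftrightarrow> pl (const c) \<pi>"
| "run \<rho> (t \<sqdot> u) \<pi> \<longleftrightarrow> run \<rho> t (push E A (ev \<rho> u) \<pi>)"

lemma run_pole: "env \<rho> \<Longrightarrow> S \<pi> \<Longrightarrow> run \<rho> t \<pi> \<Longrightarrow> pl (ev \<rho> t) \<pi>"
  by (induction t arbitrary: \<pi>) (auto intro!: pole_app T_intros)

lemma run_arg_lam:
  assumes env: "env \<rho>" and "T \<xi>" "S \<pi>"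
  shows "pl (ev \<rho> k) (push E A (ev (\<rho>(x := \<xi>)) u) (push E A \<xi> \<pi>)) \<Longrightarrow>
    run \<rho> (arg_lam x u k) (push E A \<xi> \<pi>)"
  using assms(2,3)
proof (induction u arbitrary: k \<pi>)
  case (V y)
  then show ?case
    using env by (auto simp: env_def intro!: pole_app pole_C pole_W T_intros)
next
  case (Co c)
  then show ?case
    using env by (auto intro!: pole_app pole_C const_T T_intros)
next
  case (Ap u v)
  let ?u = "ev (\<rho>(x := \<xi>)) u" and ?v = "ev (\<rho>(x := \<xi>)) v" and ?k = "ev \<rho> k"
  have T: "T ?u" "T ?v" "T ?k" using assms by auto
  note S = Ap.prems(3)
  \<comment> \<open>Run against \<open>u\<close>, \<xi>, \<open>v\<close> and the stack,
    \<open>B C (B k)\<close> applies \<open>u\<close> to \<open>v\<close> and hands the result to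
    \<open>k\<close> in front of \<xi>.\<close>
  have "pl (ev \<rho> (Co KB \<sqdot> Co KC \<sqdot> (Co KB \<sqdot> k))) (push E A ?u (push E A \<xi> (push E A ?v \<pi>)))"
    using T Ap.prems env by (simp only: ev.simps const.simps) (intro pole_app pole_B pole_C T_intros)
  then have "run \<rho> (arg_lam x u (Co KB \<sqdot> Co KC \<sqdot> (Co KB \<sqdot> k))) (push E A \<xi> (push E A ?v \<pi>))"
    by (rule Ap.IH(1)) (intro push_S T Ap.prems(2,3))+
  then have "pl (ev \<rho> (arg_lam x u (Co KB \<sqdot> Co KC \<sqdot> (Co KB \<sqdot> k)))) (push E A \<xi> (push E A ?v \<pi>))"
    by (rule run_pole[OF env, rotated]) (intro push_S T S Ap.prems(2))
  then have "pl (ev \<rho> (Co KC \<sqdot> arg_lam x u (Co KB \<sqdot> Co KC \<sqdot> (Co KB \<sqdot> k))))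
      (push E A ?v (push E A \<xi> \<pi>))"
    using T Ap.prems env by (simp only: ev.simps const.simps) (intro pole_app pole_C T_intros)
  then show ?case unfolding arg_lam.simps by (rule Ap.IH(2)) (intro Ap.prems(2,3))+
qed

lemma run_lam:
  assumes env: "env \<rho>" and "T \<xi>" "S \<pi>"
  shows "run (\<rho>(x := \<xi>)) t \<pi> \<Longrightarrow> run \<rho> (lam x t) (push E A \<xi> \<pi>)"
  using assms(3)
proof (induction t arbitrary: \<pi>)
  case (V y)
  then show ?case
    using env assms(2) by (auto simp: env_def intro!: pole_app pole_I pole_K T_intros)
next
  case (Co c)
  then show ?case
    using env assms(2) by (auto intro!: pole_app pole_K const_T T_intros)
next
  case (Ap t u)
  let ?u = "ev (\<rho>(x := \<xi>)) u" and ?l = "ev \<rho> (lam x t)"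
  have T: "T ?u" "T ?l" using assms by auto
  have "run \<rho> (lam x t) (push E A \<xi> (push E A ?u \<pi>))"
    using Ap.prems(1) unfolding run.simps by (rule Ap.IH(1)) (intro push_S T Ap.prems(2))
  then have "pl ?l (push E A \<xi> (push E A ?u \<pi>))"
    by (rule run_pole[OF env, rotated]) (intro push_S T Ap.prems assms(2))
  then have "pl (ev \<rho> (Co KC \<sqdot> lam x t)) (push E A ?u (push E A \<xi> \<pi>))"
    using T Ap.prems assms by (simp only: ev.simps const.simps) (intro pole_app pole_C T_intros)
  then show ?case unfolding lam.simps by (rule run_arg_lam[OF env assms(2) Ap.prems(2)])
qed

section \<open>Realizability of formulas\<close>

lemma tv_S: "\<pi> \<in> tv E A F \<Longrightarrow> S \<pi>"
  by (induction F arbitrary: \<pi>) (auto intro: push_S split: if_splits)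

lemma realizes_T: "\<xi> \<Vdash> F \<Longrightarrow> T \<xi>"
  by (simp add: realizes_def)

lemma realizes_env [simp]: "env \<rho> \<Longrightarrow> \<xi> \<Vdash> F \<Longrightarrow> env (\<rho>(x := \<xi>))"
  using realizes_T by simp

lemma tv_Imp: "tv E A (Imp F G) = {push E A \<xi> \<pi> | \<xi> \<pi>. \<xi> \<Vdash> F \<and> \<pi> \<in> tv E A G}"
  by (auto simp: realizes_def)

text \<open>A semantic judgement. With \<open>run\<close> in place of \<open>ev\<close> the
  application rule is a mere unfolding, and quantifiers leave the term unchanged.\<close>

definition typed :: "(nat \<Rightarrow> 'm) \<Rightarrow> tm \<Rightarrow> 'm zfe \<Rightarrow> bool" ("(_ \<turnstile> _ \<triangleright> _)" [51, 51, 51] 50) where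
  "\<rho> \<turnstile> t \<triangleright> F \<longleftrightarrow> env \<rho> \<and> (\<forall>\<pi> \<in> tv E A F. run \<rho> t \<pi>)"

lemma typed_env: "\<rho> \<turnstile> t \<triangleright> F \<Longrightarrow> env \<rho>"
  by (simp add: typed_def)

lemma typed_realizes: "\<rho> \<turnstile> t \<triangleright> F \<Longrightarrow> ev \<rho> t \<Vdash> F"
  unfolding typed_def realizes_def using run_pole tv_S by auto

lemma typed_V: "env \<rho> \<Longrightarrow> \<rho> \<turnstile> V i \<triangleright> F \<longleftrightarrow> \<rho> i \<Vdash> F"
  unfolding typed_def realizes_def by (auto simp: env_def)

lemma typed_All: "\<rho> \<turnstile> t \<triangleright> All F \<longleftrightarrow> env \<rho> \<and> (\<forall>a. \<rho> \<turnstile> t \<triangleright> F a)"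
  by (auto simp: typed_def)

lemma typed_Cond: "\<rho> \<turnstile> t \<triangleright> Cond b F \<longleftrightarrow> env \<rho> \<and> (b \<longrightarrow> \<rho> \<turnstile> t \<triangleright> F)"
  by (auto simp: typed_def)

lemma typed_allI: "(\<And>a. \<rho> \<turnstile> t \<triangleright> F a) \<Longrightarrow> \<rho> \<turnstile> t \<triangleright> All F"
  by (simp add: typed_def)

lemma typed_allE: "\<rho> \<turnstile> t \<triangleright> All F \<Longrightarrow> \<rho> \<turnstile> t \<triangleright> F a"
  by (simp add: typed_All)

lemma typed_condI: "env \<rho> \<Longrightarrow> (b \<Longrightarrow> \<rho> \<turnstile> t \<triangleright> F) \<Longrightarrow> \<rho> \<turnstile> t \<triangleright> Cond b F"
  by (simp add: typed_Cond)

text \<open>Every truth value is a set of stacks, hence included in that of \<open>Bot\<close>; ex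
  falso costs no term.\<close>

lemma typed_Bot: "\<rho> \<turnstile> t \<triangleright> Bot \<Longrightarrow> \<rho> \<turnstile> t \<triangleright> F"
  using tv_S by (auto simp: typed_def)

lemma typed_mp: "\<rho> \<turnstile> t \<triangleright> Imp F G \<Longrightarrow> \<rho> \<turnstile> u \<triangleright> F \<Longrightarrow> \<rho> \<turnstile> t \<sqdot> u \<triangleright> G"
  using typed_realizes[of \<rho> u F] unfolding typed_def tv_Imp by auto

lemma typed_app: "\<rho> \<turnstile> t \<triangleright> Imp F G \<Longrightarrow> ev \<rho> u \<Vdash> F \<Longrightarrow> \<rho> \<turnstile> t \<sqdot> u \<triangleright> G"
  unfolding typed_def tv_Imp by auto

lemma typed_VI: "env \<rho> \<Longrightarrow> \<rho> i \<Vdash> F \<Longrightarrow> \<rho> \<turnstile> V i \<triangleright> F"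
  by (simp add: typed_V)

lemma typed_cong: "tv E A F = tv E A G \<Longrightarrow> \<rho> \<turnstile> t \<triangleright> F \<longleftrightarrow> \<rho> \<turnstile> t \<triangleright> G"
  by (simp add: typed_def)

lemma realizes_cong: "tv E A F = tv E A G \<Longrightarrow> \<xi> \<Vdash> F \<longleftrightarrow> \<xi> \<Vdash> G"
  by (simp add: realizes_def)

lemma typed_notE: "\<rho> \<turnstile> t \<triangleright> Not F \<Longrightarrow> \<rho> \<turnstile> u \<triangleright> F \<Longrightarrow> \<rho> \<turnstile> t \<sqdot> u \<triangleright> G"
  unfolding Not_def by (rule typed_Bot, rule typed_mp)

lemma typed_lam:
  assumes "env \<rho>" and "\<And>\<xi>. \<xi> \<Vdash> F \<Longrightarrow> env (\<rho>(x := \<xi>)) \<Longrightarrow> \<rho>(x := \<xi>) \<turnstile> t \<triangleright> G"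
  shows "\<rho> \<turnstile> lam x t \<triangleright> Imp F G"
  unfolding typed_def tv_Imp
proof (intro conjI ballI)
  fix \<pi>' assume "\<pi>' \<in> {push E A \<xi> \<pi> | \<xi> \<pi>. \<xi> \<Vdash> F \<and> \<pi> \<in> tv E A G}"
  then obtain \<xi> \<pi> where \<pi>': "\<pi>' = push E A \<xi> \<pi>" "\<xi> \<Vdash> F" "\<pi> \<in> tv E A G" by blast
  have "run (\<rho>(x := \<xi>)) t \<pi>"
    using assms(2)[OF \<pi>'(2) realizes_env[OF assms(1) \<pi>'(2)]] \<pi>'(3) unfolding typed_def by simp
  then show "run \<rho> (lam x t) \<pi>'"
    unfolding \<pi>'(1) by (rule run_lam[OF assms(1) realizes_T[OF \<pi>'(2)] tv_S[OF \<pi>'(3)]])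
qed (rule assms(1))

lemma typed_notI:
  assumes "env \<rho>" and "\<And>\<xi>. \<xi> \<Vdash> F \<Longrightarrow> env (\<rho>(x := \<xi>)) \<Longrightarrow> \<rho>(x := \<xi>) \<turnstile> t \<triangleright> Bot"
  shows "\<rho> \<turnstile> lam x t \<triangleright> Not F"
  unfolding Not_def using assms by (rule typed_lam)

text \<open>The continuation of a stack \<pi> in the truth value of \<open>F\<close> realizes
  \<open>Not F\<close>: it drops its own stack and runs its argument against \<pi>.\<close>

lemma typed_contradiction:
  assumes env: "env \<rho>" and t: "\<And>k. k \<Vdash> Not F \<Longrightarrow> env (\<rho>(x := k)) \<Longrightarrow> \<rho>(x := k) \<turnstile> t \<triangleright> Bot"
  shows "\<rho> \<turnstile> Co KCC \<sqdot> lam x t \<triangleright> F"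
  unfolding typed_def
proof (intro conjI ballI)
  fix \<pi> assume \<pi>: "\<pi> \<in> tv E A F"
  then have S: "S \<pi>" by (rule tv_S)
  let ?k = "cont E A \<pi>"
  have kT: "T ?k" using S by (rule cont_T)
  have k: "?k \<Vdash> Not F"
    unfolding realizes_def[of E A ?k] Not_def tv_Imp
  proof (intro conjI ballI)
    fix \<pi>' assume "\<pi>' \<in> {push E A \<xi> \<pi> | \<xi> \<pi>. \<xi> \<Vdash> F \<and> \<pi> \<in> tv E A Bot}"
    then obtain \<xi> \<sigma> where \<pi>': "\<pi>' = push E A \<xi> \<sigma>" "\<xi> \<Vdash> F" "S \<sigma>" by auto
    then have "pl \<xi> \<pi>" using \<pi> unfolding realizes_def by simp
    then show "pl ?k \<pi>'" unfolding \<pi>'(1) using \<pi>' S realizes_T by (intro pole_cont)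
  qed (rule kT)
  have "run (\<rho>(x := ?k)) t \<pi>"
    using t[OF k realizes_env[OF env k]] S unfolding typed_def by simp
  then have "run \<rho> (lam x t) (push E A ?k \<pi>)" by (rule run_lam[OF env kT S])
  then have "pl (ev \<rho> (lam x t)) (push E A ?k \<pi>)" by (rule run_pole[OF env push_S[OF kT S]])
  then show "run \<rho> (Co KCC \<sqdot> lam x t) \<pi>"
    using S env by (simp only: run.simps const.simps) (intro pole_cc T_intros)
qed (rule env)

section \<open>Turing's fixed point combinator\<close>

definition fix_half :: tm where "fix_half = lam 0 (lam 1 (V 1 \<sqdot> (V 0 \<sqdot> V 0 \<sqdot> V 1)))"
definition fixpoint :: tm where "fixpoint = fix_half \<sqdot> fix_half"

text \<open>\<open>fixpoint\<close> at \<open>f\<close> reduces to \<open>f\<close> applied to that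
  same term. The premise \<open>h\<close> about this term is to be supplied by an induction in the
  ground model.\<close>

lemma typed_fixpoint:
  assumes "env \<rho>" and f: "\<rho> \<turnstile> f \<triangleright> Imp H F" and h: "ev \<rho> (fixpoint \<sqdot> f) \<Vdash> H"
  shows "\<rho> \<turnstile> fixpoint \<sqdot> f \<triangleright> F"
  unfolding typed_def
proof (intro conjI ballI)
  let ?h = "ev \<rho> fix_half" and ?f = "ev \<rho> f"
  have T: "T ?h" "T ?f" using assms(1) by (rule ev_T)+
  fix \<pi> assume \<pi>: "\<pi> \<in> tv E A F"
  then have S: "S \<pi>" by (rule tv_S)
  have "pl ?f (push E A (ev \<rho> (fixpoint \<sqdot> f)) \<pi>)"
    using typed_realizes[OF f] \<pi> h unfolding realizes_def[of E A ?f] tv_Imp by blast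
  \<comment> \<open>Exactness of the abstraction matters here: the argument left on the stack is
    literally the term about which \<open>h\<close> speaks.\<close>
  then have "run (\<rho>(0 := ?h, 1 := ?f)) (V 1 \<sqdot> (V 0 \<sqdot> V 0 \<sqdot> V 1)) \<pi>"
    by (simp add: fixpoint_def)
  then have "run \<rho> fix_half (push E A ?h (push E A ?f \<pi>))"
    unfolding fix_half_def using T S assms(1) unfolding fix_half_def
    by (intro run_lam T_intros)
  then show "run \<rho> (fixpoint \<sqdot> f) \<pi>"
    unfolding fixpoint_def run.simps .
qed (rule assms(1))


section \<open>Definability of truth values and comprehension\<close>

definition dtv :: "((nat \<Rightarrow> 'm) \<Rightarrow> 'm zfe) \<Rightarrow> bool" where
  "dtv \<phi> \<longleftrightarrow> dp E (\<lambda>s. s 0 \<in> tv E A (\<phi> (\<lambda>i. s (Suc i))))"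

lemma dtv_ren: "dtv \<phi> \<Longrightarrow> dtv (\<lambda>s. \<phi> (\<lambda>i. s (r i)))"
  unfolding dtv_def
  using dp_ren[of E "\<lambda>s. s 0 \<in> tv E A (\<phi> (\<lambda>i. s (Suc i)))" "case_nat 0 (\<lambda>i. Suc (r i))"] by simp

lemma dp_tv:
  assumes "dtv \<phi>" "df E f" shows "dp E (\<lambda>s. f s \<in> tv E A (\<phi> s))"
  using dp_subst[OF assms(1)[unfolded dtv_def] assms(2)] by simp

text \<open>\<open>star\<close> is given by a description; its graph is first-order, and on terms
  and stacks the two agree.\<close>

definition pole_graph :: "'m \<Rightarrow> 'm \<Rightarrow> bool" where
  "pole_graph \<xi> \<pi> \<longleftrightarrow> (\<exists>p. E (opair E (opair E \<xi> \<pi>) p) (star_fun A) \<and> E p (pole A))"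

lemma pole_graph: "T \<xi> \<Longrightarrow> S \<pi> \<Longrightarrow> pole_graph \<xi> \<pi> \<longleftrightarrow> pl \<xi> \<pi>"
  unfolding pole_graph_def using star_graph by simp

lemma dp_pole_graph: "df E f \<Longrightarrow> df E g \<Longrightarrow> dp E (\<lambda>s. pole_graph (f s) (g s))"
proof (rule dp2)
  show "dp E (\<lambda>s. pole_graph (s 0) (s 1))"
    unfolding pole_graph_def by (intro dp_intros df_opair)
qed

lemma dp_realizes:
  assumes "df E f" "dtv \<phi>" shows "dp E (\<lambda>s. f s \<Vdash> \<phi> s)"
proof -
  have eq: "\<xi> \<Vdash> F \<longleftrightarrow> T \<xi> \<and> (\<forall>\<pi>. \<pi> \<in> tv E A F \<longrightarrow> pole_graph \<xi> \<pi>)" for \<xi> F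
  proof (cases "T \<xi>")
    case True
    then have "\<pi> \<in> tv E A F \<Longrightarrow> pole_graph \<xi> \<pi> \<longleftrightarrow> pl \<xi> \<pi>" for \<pi>
      by (intro pole_graph tv_S)
    with True show ?thesis unfolding realizes_def by auto
  qed (simp add: realizes_def)
  show ?thesis unfolding eq
    by (intro dp_intros dp_tv dp_pole_graph dtv_ren[OF assms(2)] df_ren[OF assms(1)] assms(1))
qed

lemma dtv_NotEps: assumes "df E f" "df E g" shows "dtv (\<lambda>s. NotEps (f s) (g s))"
  unfolding dtv_def tv.simps mem_Collect_eq
  by (intro dp_conj dp_mem df_opair df_var df_const df_ren[OF assms(1)] df_ren[OF assms(2)])

lemma dtv_Bot: "dtv (\<lambda>s. Bot)"
  unfolding dtv_def tv.simps mem_Collect_eq by (intro dp_intros)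

lemma dtv_Imp:
  assumes "dtv \<phi>" "dtv \<psi>" shows "dtv (\<lambda>s. Imp (\<phi> s) (\<psi> s))"
proof -
  have eq: "\<pi> \<in> tv E A (Imp F G) \<longleftrightarrow> (\<exists>\<xi> \<rho>. \<xi> \<Vdash> F \<and> \<rho> \<in> tv E A G \<and>
      E (opair E (opair E \<xi> \<rho>) \<pi>) (push_fun A))" for \<pi> F G
  proof
    assume "\<pi> \<in> tv E A (Imp F G)"
    then obtain \<xi> \<rho> where *: "\<pi> = push E A \<xi> \<rho>" "\<xi> \<Vdash> F" "\<rho> \<in> tv E A G"
      unfolding tv_Imp by blast
    then have "E (opair E (opair E \<xi> \<rho>) \<pi>) (push_fun A)"
      using push_graph[OF realizes_T[OF *(2)] tv_S[OF *(3)]] by simp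
    with * show "\<exists>\<xi> \<rho>. \<xi> \<Vdash> F \<and> \<rho> \<in> tv E A G \<and> E (opair E (opair E \<xi> \<rho>) \<pi>) (push_fun A)"
      by (intro exI conjI)
  next
    assume "\<exists>\<xi> \<rho>. \<xi> \<Vdash> F \<and> \<rho> \<in> tv E A G \<and> E (opair E (opair E \<xi> \<rho>) \<pi>) (push_fun A)"
    then obtain \<xi> \<rho> where *: "\<xi> \<Vdash> F" "\<rho> \<in> tv E A G"
      "E (opair E (opair E \<xi> \<rho>) \<pi>) (push_fun A)" by (elim exE conjE)
    then have "\<pi> = push E A \<xi> \<rho>" using push_graph[OF realizes_T[OF *(1)] tv_S[OF *(2)]] by simp
    with * show "\<pi> \<in> tv E A (Imp F G)" unfolding tv_Imp by blast
  qed
  show ?thesis unfolding dtv_def eq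
    by (intro dp_intros dp_tv dp_realizes df_opair dtv_ren[OF assms(1)] dtv_ren[OF assms(2)])
qed

lemma dtv_All:
  assumes "dtv (\<lambda>s. \<phi> (\<lambda>i. s (Suc i)) (s 0))" shows "dtv (\<lambda>s. All (\<lambda>a. \<phi> s a))"
proof -
  have eq: "\<pi> \<in> tv E A (All F) \<longleftrightarrow> (\<exists>a. \<pi> \<in> tv E A (F a))" for \<pi> F by simp
  have "dp E (\<lambda>s. s 0 \<in> tv E A (\<phi> (\<lambda>i. s (Suc (Suc i))) (s (Suc 0))))"
    using assms unfolding dtv_def .
  from dp_ren[OF this, of "case_nat 1 (case_nat 0 (\<lambda>i. Suc (Suc i)))"]
  have "dp E (\<lambda>s. s (Suc 0) \<in> tv E A (\<phi> (\<lambda>i. s (Suc (Suc i))) (s 0)))"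
    by (simp only: nat.case One_nat_def)
  then show ?thesis unfolding dtv_def eq by (rule dp_ex)
qed

lemma dtv_Cond: "dp E P \<Longrightarrow> dtv \<phi> \<Longrightarrow> dtv (\<lambda>s. Cond (P s) (\<phi> s))"
proof -
  assume P: "dp E P" and \<phi>: "dtv \<phi>"
  have eq: "\<pi> \<in> tv E A (Cond b F) \<longleftrightarrow> b \<and> \<pi> \<in> tv E A F" for \<pi> b F by simp
  show ?thesis unfolding dtv_def eq
    by (intro dp_intros dp_ren[OF P] dp_tv dtv_ren[OF \<phi>])
qed

lemma dtv_Not: "dtv \<phi> \<Longrightarrow> dtv (\<lambda>s. Not (\<phi> s))"
  unfolding Not_def by (intro dtv_Imp dtv_Bot)

lemma df_if: "df E f \<Longrightarrow> df E g \<Longrightarrow> df E (\<lambda>s. if b then f s else g s)"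
  by (cases b) simp_all

lemmas dtv_intros = dtv_NotEps dtv_Bot dtv_Not dtv_Imp dtv_All dtv_Cond df_if dp_intros

text \<open>The set consists of the pairs of a \<open>w\<close> in \<open>a\<close> and a stack in
  the truth value of \<open>\<phi> w\<close>. For \<open>w\<close> outside \<open>a\<close>,
  \<open>NotEps w X\<close> is realized by every term.\<close>

lemma comprehension:
  assumes "dtv (\<lambda>s. \<phi> (s 0))"
  shows "\<exists>X. \<forall>w. tv E A (NotEps w X) = (if E w a then tv E A (\<phi> w) else {})"
proof -
  have "dp E (\<lambda>s. \<exists>w \<pi>. s 0 = opair E w \<pi> \<and> \<pi> \<in> tv E A (\<phi> w))"
    by (intro dp_intros dp_tv df_opair dtv_ren[OF assms, of "\<lambda>_. Suc 0"])
  from separation[OF this, of "times E a (stacks A)"] obtain X where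
    X: "\<And>p. E p X \<longleftrightarrow> E p (times E a (stacks A)) \<and> (\<exists>w \<pi>. p = opair E w \<pi> \<and> \<pi> \<in> tv E A (\<phi> w))"
    by blast
  show ?thesis by (rule exI[of _ X]) (auto simp: X mem_times tv_S)
qed


section \<open>Induction along the ultrafilter\<close>

text \<open>This is \<open>\<langle>y<x\<rangle> \<ge> b\<close> computed in \<open>{0,1}\<close>;
  for \<open>b\<close> false it relates everything to everything.\<close>

definition rel :: "bool \<Rightarrow> 'm \<Rightarrow> 'm \<Rightarrow> bool" where
  "rel b y x \<longleftrightarrow> (b \<longrightarrow> below E y x)"

text \<open>Classically, every element of \<open>X\<close> has a \<open>rel b\<close> predecessor in
  \<open>X\<close>, so \<open>X\<close> has no minimal element.\<close>

definition Desc :: "bool \<Rightarrow> 'm \<Rightarrow> 'm zfe" where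
  "Desc b X = All (\<lambda>x. Imp (All (\<lambda>y. Cond (rel b y x) (NotEps y X))) (NotEps x X))"

definition DF :: "bool \<Rightarrow> 'm zfe" where
  "DF b = All (\<lambda>X. Imp (Desc b X) (All (\<lambda>x. NotEps x X)))"

lemma D_formula_eq: "D_formula E (if b then one E else zero E) = DF b"
proof -
  have "bool_ge E (chi E (below E) y x) (if b then one E else zero E) \<longleftrightarrow> rel b y x" for x y
    by (auto simp: bool_ge_def chi_def rel_def)
  then show ?thesis unfolding D_formula_def DF_def Desc_def by simp
qed

text \<open>Well-foundedness speaks of sets, so comprehension over \<open>a\<close> turns \<phi>
  into one; outside \<open>a\<close> the truth value is empty and the induction step is
  trivial.\<close>

lemma DF_induct:
  assumes \<phi>: "dtv (\<lambda>s. \<phi> (s 0))" and g: "\<rho> \<turnstile> g \<triangleright> DF b"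
    and step: "\<And>x u. E x a \<Longrightarrow> u \<Vdash> All (\<lambda>y. Cond (E y a \<and> rel b y x) (\<phi> y)) \<Longrightarrow>
      env (\<rho>(i := u)) \<Longrightarrow> \<rho>(i := u) \<turnstile> t \<triangleright> \<phi> x"
    and w: "E w a"
  shows "\<rho> \<turnstile> g \<sqdot> lam i t \<triangleright> \<phi> w"
proof -
  obtain X where X: "\<And>w. tv E A (NotEps w X) = (if E w a then tv E A (\<phi> w) else {})"
    using comprehension[OF \<phi>, of a] by blast
  have env: "env \<rho>" using g by (rule typed_env)
  have "\<rho> \<turnstile> lam i t \<triangleright> Desc b X" unfolding Desc_def
  proof (intro typed_allI typed_lam env)
    fix x u assume u: "u \<Vdash> All (\<lambda>y. Cond (rel b y x) (NotEps y X))" and env': "env (\<rho>(i := u))"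
    show "\<rho>(i := u) \<turnstile> t \<triangleright> NotEps x X"
    proof (cases "E x a")
      case True
      have "tv E A (All (\<lambda>y. Cond (rel b y x) (NotEps y X))) =
          tv E A (All (\<lambda>y. Cond (E y a \<and> rel b y x) (\<phi> y)))"
        unfolding tv.simps(4,5) X by auto
      from step[OF True u[unfolded realizes_cong[OF this]] env'] show ?thesis
        using typed_cong[of "NotEps x X" "\<phi> x"] X True by simp
    next
      case False
      then show ?thesis using X env' unfolding typed_def by simp
    qed
  qed
  with typed_allE[OF g[unfolded DF_def]] have "\<rho> \<turnstile> g \<sqdot> lam i t \<triangleright> All (\<lambda>x. NotEps x X)"
    by (rule typed_mp)
  then have "\<rho> \<turnstile> g \<sqdot> lam i t \<triangleright> NotEps w X" by (rule typed_allE)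
  then show ?thesis using typed_cong[of "NotEps w X" "\<phi> w"] X w by simp
qed


section \<open>The pigeonhole principle\<close>

text \<open>If k is not an image of a set of terms, then two distinct elements of k share a realizer.\<close>

lemma pigeonhole:
  assumes k: "ordinal E k" "\<And>f. \<not> onto (terms A) f k" and \<phi>: "dtv (\<lambda>s. \<phi> (s 0))" and env: "env \<rho>"
    and t: "\<And>y z a. E y k \<Longrightarrow> E z k \<Longrightarrow> E y z \<Longrightarrow> a \<Vdash> \<phi> y \<Longrightarrow> a \<Vdash> \<phi> z \<Longrightarrow>
      env (\<rho>(i := a)) \<Longrightarrow> \<rho>(i := a) \<turnstile> t \<triangleright> Bot"
  shows "\<exists>y. E y k \<and> ev \<rho> (lam i t) \<Vdash> Not (\<phi> y)"
proof (rule ccontr)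
  assume "\<not> ?thesis"
  then have none: "\<not> ev \<rho> (lam i t) \<Vdash> Not (\<phi> y)" if "E y k" for y using that by simp
  let ?n = "ev \<rho> (lam i t)"
  \<comment> \<open>\<open>bad a y\<close> means that \<open>a\<close> realizes
    \<open>\<phi> y\<close> and defeats the candidate \<open>?n\<close>. If \<open>?n\<close> fails
    at every \<open>y\<close>, these pairs map terms onto \<open>k\<close>, since by
    \<open>t\<close> no term is bad for two values. Graphs keep the relation definable.\<close>
  define bad where "bad a y \<longleftrightarrow> a \<Vdash> \<phi> y \<and> (\<exists>\<pi> \<sigma>. S \<pi> \<and> E (opair E (opair E a \<pi>) \<sigma>) (push_fun A) \<and>
      \<not> pole_graph ?n \<sigma>)" for a y
  have n: "T ?n" using env by (rule ev_T)
  have bad: "bad a y \<longleftrightarrow> a \<Vdash> \<phi> y \<and> (\<exists>\<pi>. S \<pi> \<and> \<not> pl ?n (push E A a \<pi>))" for a y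
  proof (cases "a \<Vdash> \<phi> y")
    case True
    then have "S \<pi> \<Longrightarrow> E (opair E (opair E a \<pi>) \<sigma>) (push_fun A) \<longleftrightarrow> \<sigma> = push E A a \<pi>" for \<pi> \<sigma>
      by (intro push_graph realizes_T)
    moreover have "S \<pi> \<Longrightarrow> pole_graph ?n (push E A a \<pi>) \<longleftrightarrow> pl ?n (push E A a \<pi>)" for \<pi>
      by (intro pole_graph n push_S realizes_T[OF True])
    ultimately show ?thesis unfolding bad_def using True by auto
  qed (simp add: bad_def)
  have dp: "dp E (\<lambda>s. \<exists>a y. s 0 = opair E a y \<and> bad a y)"
    unfolding bad_def
    by (intro dp_intros df_opair dp_realizes dp_pole_graph dtv_ren[OF \<phi>, of "\<lambda>_. 0"])
  then obtain f where f: "\<And>p. E p f \<longleftrightarrow> E p (times E (terms A) k) \<and> (\<exists>a y. p = opair E a y \<and> bad a y)"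
    using separation[OF dp, of "times E (terms A) k"] by blast
  have f': "E (opair E a y) f \<longleftrightarrow> E y k \<and> bad a y" for a y
    unfolding f mem_times bad using realizes_T by auto
  have not_both: "\<not> (bad a y \<and> bad a z)" if "E y k" "E z k" "E y z" for a y z
  proof
    assume b: "bad a y \<and> bad a z"
    then have a: "a \<Vdash> \<phi> y" "a \<Vdash> \<phi> z" using bad by simp_all
    from b obtain \<pi> where \<pi>: "S \<pi>" "\<not> pl ?n (push E A a \<pi>)" using bad[of a y] by auto
    have "\<rho>(i := a) \<turnstile> t \<triangleright> Bot" by (rule t[OF that a realizes_env[OF env a(1)]])
    then have "run (\<rho>(i := a)) t \<pi>" using \<pi>(1) unfolding typed_def by simp
    then have "run \<rho> (lam i t) (push E A a \<pi>)" by (rule run_lam[OF env realizes_T[OF a(1)] \<pi>(1)])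
    then have "pl ?n (push E A a \<pi>)"
      by (rule run_pole[OF env push_S[OF realizes_T[OF a(1)] \<pi>(1)]])
    with \<pi>(2) show False by simp
  qed
  have ex: "\<exists>a. bad a y" if "E y k" for y
  proof -
    from none[OF that] n obtain \<sigma> where \<sigma>: "\<sigma> \<in> tv E A (Not (\<phi> y))" "\<not> pl ?n \<sigma>"
      unfolding realizes_def[of E A ?n] by blast
    then show ?thesis unfolding Not_def tv_Imp bad by auto
  qed
  have "onto (terms A) f k" unfolding onto_def f'
  proof (intro conjI allI impI)
    fix y assume y: "E y k"
    from ex[OF y] obtain a where a: "bad a y" by blast
    then have "T a" unfolding bad using realizes_T by auto
    with a y show "\<exists>a. T a \<and> E y k \<and> bad a y" by blast
  next
    fix a y z assume "E y k \<and> E z k \<and> (E y k \<and> bad a y) \<and> (E z k \<and> bad a z)"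
    then show "y = z"
      using ordinal_linear[OF k(1), of y z] not_both[of y z a] not_both[of z y a] by auto
  qed
  with k(2) show False by simp
qed

text \<open>One term serves both values of \<open>b\<close>. For \<open>b\<close> true the
  pigeonhole principle is applied with \<open>x\<close> fixed to \<open>e\<close>; for
  \<open>b\<close> false \<open>t\<close> already applies with both \<open>y\<close> and
  \<open>z\<close> equal to \<open>e\<close>.\<close>

lemma pigeonhole_bool:
  assumes k: "ordinal E k" "\<And>f. \<not> onto (terms A) f k" and ne: "E e k"
    and \<phi>: "\<And>x. dtv (\<lambda>s. \<phi> x (s 0))" and env: "env \<rho>"
    and t: "\<And>x y z a. E x k \<Longrightarrow> E y k \<Longrightarrow> E z k \<Longrightarrow> (b \<longrightarrow> E y z) \<Longrightarrow> a \<Vdash> \<phi> x y \<Longrightarrow> a \<Vdash> \<phi> x z \<Longrightarrow>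
      env (\<rho>(i := a)) \<Longrightarrow> \<rho>(i := a) \<turnstile> t \<triangleright> Bot"
    and dummy: "\<And>x x' y. b \<Longrightarrow> \<phi> x y = \<phi> x' y"
  shows "\<exists>y. E y k \<and> (\<forall>x. E x k \<longrightarrow> ev \<rho> (lam i t) \<Vdash> Not (\<phi> x y))"
proof (cases b)
  case True
  have "\<exists>y. E y k \<and> ev \<rho> (lam i t) \<Vdash> Not (\<phi> e y)"
  proof (rule pigeonhole[OF k \<phi> env])
    fix y z a assume "E y k" "E z k" "E y z" "a \<Vdash> \<phi> e y" "a \<Vdash> \<phi> e z" "env (\<rho>(i := a))"
    then show "\<rho>(i := a) \<turnstile> t \<triangleright> Bot" using t[OF ne, of y z a] by simp
  qed
  then show ?thesis using dummy[OF True] by metis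
next
  case False
  have "ev \<rho> (lam i t) \<Vdash> Not (\<phi> x e)" if x: "E x k" for x
  proof (rule typed_realizes, rule typed_notI[OF env])
    fix \<xi> assume "\<xi> \<Vdash> \<phi> x e" "env (\<rho>(i := \<xi>))"
    then show "\<rho>(i := \<xi>) \<turnstile> t \<triangleright> Bot" using t[OF x ne ne] False by simp
  qed
  then show ?thesis using ne by blast
qed

lemma tv_Not_antimono: "tv E A F \<subseteq> tv E A G \<Longrightarrow> tv E A (Not G) \<subseteq> tv E A (Not F)"
  unfolding Not_def tv_Imp realizes_def by blast


section \<open>D contains at most one of two complementary elements\<close>

definition Q :: "'m \<Rightarrow> bool \<Rightarrow> 'm \<Rightarrow> 'm \<Rightarrow> bool" where
  "Q k b y x \<longleftrightarrow> E y k \<and> (b \<longrightarrow> E y x)"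

text \<open>The recursion clause of "rank of y at most rank of x": each predecessor \<open>y\<close>
  is again related to some predecessor \<open>x\<close>. One of the two orders is trivial on
  \<open>k\<close>, so the single argument \<open>z\<close> stands for the coordinate that
  matters.\<close>

definition Phi :: "'m \<Rightarrow> bool \<Rightarrow> 'm \<Rightarrow> 'm \<Rightarrow> 'm zfe" where
  "Phi k b z g = All (\<lambda>y. Cond (Q k b y z)
    (Not (All (\<lambda>x. Cond (Q k (\<not> b) x z) (Not (NotEps (if b then y else x) g))))))"

lemma Phi_mono:
  assumes "\<And>z. tv E A (NotEps z g) \<subseteq> tv E A (NotEps z g')"
  shows "tv E A (Phi k b z g) \<subseteq> tv E A (Phi k b z g')"
proof -
  have 1: "tv E A (All (\<lambda>x. Cond (Q k (\<not> b) x z) (Not (NotEps (if b then y else x) g')))) \<subseteq>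
      tv E A (All (\<lambda>x. Cond (Q k (\<not> b) x z) (Not (NotEps (if b then y else x) g))))" for y
    unfolding tv.simps(4,5)
    using tv_Not_antimono[OF assms] by (intro UN_mono subset_refl) auto
  show ?thesis unfolding Phi_def tv.simps(4)[of E A "\<lambda>y. Cond (Q k b y z) (H y)" for H]
    tv.simps(5)[of E A "Q k b y z" for y]
    using tv_Not_antimono[OF 1] by (intro UN_mono subset_refl) auto
qed

text \<open>The order of truth values makes \<open>Phi\<close> monotone, so Knaster and Tarski's theorem inside the
  power set of \<open>k \<times> \<Pi>\<close> solves the recursive definition of the comparison
  formula up to equality of truth values. For b true the argument x is a dummy, for b false y is.\<close>

lemma ex_fixpoint: "\<exists>g. \<forall>z. E z k \<longrightarrow> tv E A (NotEps z g) = tv E A (Phi k b z g)"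
proof -
  \<comment> \<open>The post-fixed points; their union \<open>h\<close> is the greatest one.\<close>
  define post where "post g \<longleftrightarrow> (\<forall>z \<pi>. \<pi> \<in> tv E A (NotEps z g) \<longrightarrow> E z k \<and> \<pi> \<in> tv E A (Phi k b z g))" for g
  have dp: "dp E (\<lambda>s. \<exists>z \<pi> g. s 0 = opair E z \<pi> \<and> post g \<and> \<pi> \<in> tv E A (NotEps z g))"
    unfolding post_def Phi_def Q_def
    by (intro dtv_intros df_opair dp_tv)
  from separation[OF dp, of "times E k (stacks A)"] obtain h where
    h: "\<And>p. E p h \<longleftrightarrow> E p (times E k (stacks A)) \<and>
      (\<exists>z \<pi> g. p = opair E z \<pi> \<and> post g \<and> \<pi> \<in> tv E A (NotEps z g))" by blast
  have tvh: "\<pi> \<in> tv E A (NotEps z h) \<longleftrightarrow> (\<exists>g. post g \<and> \<pi> \<in> tv E A (NotEps z g))" for z \<pi>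
  proof -
    have "post g \<Longrightarrow> \<pi> \<in> tv E A (NotEps z g) \<Longrightarrow> S \<pi> \<and> E z k" for g
      using tv_S unfolding post_def by blast
    then show ?thesis by (auto simp: h mem_times)
  qed
  have le: "tv E A (NotEps z g) \<subseteq> tv E A (NotEps z h)" if "post g" for z g
    using tvh that by blast
  have post: "post h" unfolding post_def
  proof (intro allI impI)
    fix z \<pi> assume "\<pi> \<in> tv E A (NotEps z h)"
    then obtain g where g: "post g" "\<pi> \<in> tv E A (NotEps z g)" using tvh by blast
    then have "E z k" "\<pi> \<in> tv E A (Phi k b z g)" unfolding post_def by blast+
    moreover have "tv E A (Phi k b z g) \<subseteq> tv E A (Phi k b z h)"
      by (rule Phi_mono) (rule le[OF g(1)])
    ultimately show "E z k \<and> \<pi> \<in> tv E A (Phi k b z h)" by blast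
  qed
  \<comment> \<open>\<open>Phi\<close> at \<open>h\<close>, restricted to \<open>k\<close>, is again
    post-fixed, hence included in \<open>h\<close>; so \<open>h\<close> is a fixed point.\<close>
  have "dtv (\<lambda>s. Phi k b (s 0) h)" unfolding Phi_def Q_def by (intro dtv_intros)
  from comprehension[OF this, of k] obtain g where
    g: "\<And>z. tv E A (NotEps z g) = (if E z k then tv E A (Phi k b z h) else {})" by blast
  have hg: "tv E A (NotEps z h) \<subseteq> tv E A (NotEps z g)" for z
    using post unfolding g post_def by auto
  have "post g" unfolding post_def
  proof (intro allI impI)
    fix z \<pi> assume "\<pi> \<in> tv E A (NotEps z g)"
    then have "E z k" "\<pi> \<in> tv E A (Phi k b z h)" unfolding g by (auto split: if_splits)
    then show "E z k \<and> \<pi> \<in> tv E A (Phi k b z g)" using Phi_mono[OF hg] by blast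
  qed
  then have "tv E A (NotEps z g) = tv E A (NotEps z h)" for z using le hg by blast
  then have "E z k \<Longrightarrow> tv E A (NotEps z h) = tv E A (Phi k b z h)" for z using g by auto
  then show ?thesis by blast
qed

section \<open>Conjunction and the incompatibility term\<close>

lemma typed_ConjI:
  assumes "env \<rho>" "\<And>k. env (\<rho>(i := k)) \<Longrightarrow> \<rho>(i := k) \<turnstile> t \<triangleright> F" "\<And>k. env (\<rho>(i := k)) \<Longrightarrow> \<rho>(i := k) \<turnstile> u \<triangleright> G"
  shows "\<rho> \<turnstile> lam i (V i \<sqdot> t \<sqdot> u) \<triangleright> Conj F G"
  unfolding Conj_def
proof (rule typed_notI[OF assms(1)])
  fix k assume k: "k \<Vdash> Imp F (Not G)" and env: "env (\<rho>(i := k))"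
  have "\<rho>(i := k) \<turnstile> V i \<triangleright> Imp F (Not G)" using k env by (simp add: typed_V)
  then show "\<rho>(i := k) \<turnstile> V i \<sqdot> t \<sqdot> u \<triangleright> Bot"
    by (rule typed_notE[OF typed_mp[OF _ assms(2)[OF env]] assms(3)[OF env]])
qed

lemma typed_ConjE:
  assumes c: "\<rho> \<turnstile> c \<triangleright> Conj F G" and t: "\<And>p q. p \<Vdash> F \<Longrightarrow> q \<Vdash> G \<Longrightarrow> env (\<rho>(i := p, j := q)) \<Longrightarrow>
      \<rho>(i := p, j := q) \<turnstile> t \<triangleright> Bot"
  shows "\<rho> \<turnstile> c \<sqdot> lam i (lam j t) \<triangleright> H"
  using c unfolding Conj_def
proof (rule typed_notE)
  show "\<rho> \<turnstile> lam i (lam j t) \<triangleright> Imp F (Not G)"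
    by (intro typed_lam typed_notI typed_env[OF c] t)
qed

text \<open>Variables 0 and 1 receive the two well-foundedness proofs, 2 and 3 the pigeonhole
  refutations given by the last two arguments. Neither value of the Boolean is built in.\<close>

definition incompatible :: tm where
  "incompatible = lam 0 (lam 1 (lam 2 (lam 3
      (V 0 \<sqdot> lam 4 (lam 5 (V 3 \<sqdot> lam 6 (V 6 \<sqdot> V 5 \<sqdot> V 4))) \<sqdot>
       (V 1 \<sqdot> lam 4 (lam 5 (V 2 \<sqdot> lam 6 (V 6 \<sqdot> V 5 \<sqdot> V 4))))))
    \<sqdot> lam 4 (V 4 \<sqdot> lam 5 (lam 6 (V 4 \<sqdot> lam 7 (lam 8 (V 7 \<sqdot> V 6)))))
    \<sqdot> lam 4 (V 4 \<sqdot> lam 5 (lam 6 (V 4 \<sqdot> lam 7 (lam 8 (V 7 \<sqdot> lam 9 (V 6 \<sqdot> V 9))))))))"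

lemma realizes_Cond: "\<xi> \<Vdash> Cond b F \<longleftrightarrow> T \<xi> \<and> (b \<longrightarrow> \<xi> \<Vdash> F)"
  by (auto simp: realizes_def)

lemma realizes_All: "\<xi> \<Vdash> All F \<longleftrightarrow> (\<forall>a. \<xi> \<Vdash> F a)"
  by (auto simp: realizes_def)

lemma realizes_All_CondI: "T \<xi> \<Longrightarrow> (\<And>x. P x \<Longrightarrow> \<xi> \<Vdash> F x) \<Longrightarrow> \<xi> \<Vdash> All (\<lambda>x. Cond (P x) (F x))"
  by (simp add: realizes_All realizes_Cond)

lemma realizes_All_CondE: "\<xi> \<Vdash> All (\<lambda>x. Cond (P x) (F x)) \<Longrightarrow> P x \<Longrightarrow> \<xi> \<Vdash> F x"
  by (auto simp: realizes_All realizes_Cond)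

text \<open>Compare the orders \<open>below\<close> along b (variable y) and along \<open>\<not> b\<close> (variable x) on k:
  \<open>G x y\<close> says that the rank of y is at most that of x. If every y satisfied G for some x, then
  a minimal such x would determine the rank of y, against the pigeonhole principle; so some \<open>y0\<close>
  has rank above all x. But then \<open>x \<mapsto> rank x + 1\<close> is attained below \<open>y0\<close> and contradicts the pigeonhole
  principle in the other direction.\<close>

lemma typed_incompatible:
  assumes env: "env \<rho>" shows "\<rho> \<turnstile> incompatible \<triangleright> Imp (DF b) (Imp (DF (\<not> b)) Bot)"
proof -
  obtain k where k: "ordinal E k" "\<And>f. \<not> onto (terms A) f k"
    using ex_ordinal_not_onto[of "terms A"] by metis
  have "\<exists>e. E e k"
  proof (rule ccontr)
    assume "\<nexists>e. E e k"
    then have "onto (terms A) k k" unfolding onto_def by simp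
    with k show False by simp
  qed
  then obtain e where e: "E e k" by blast
  obtain g where g: "\<And>z. E z k \<Longrightarrow> tv E A (NotEps z g) = tv E A (Phi k b z g)"
    using ex_fixpoint by blast
  define G where "G x y = NotEps (if b then y else x) g" for x y
  have G: "tv E A (G x y) = tv E A (All (\<lambda>y'. Cond (Q k b y' y)
      (Not (All (\<lambda>x'. Cond (Q k (\<not> b) x' x) (Not (G x' y')))))))" if "E x k" "E y k" for x y
    using that g[of x] g[of y] unfolding G_def Phi_def Q_def by (cases b) simp_all
  \<comment> \<open>\<open>F1 x y\<close> makes \<open>x\<close> minimal with \<open>G x y\<close>;
    \<open>F2 y x\<close> below makes \<open>y\<close> minimal with \<open>G x y\<close>
    false.\<close>
  define F1 where "F1 x y = Conj (G x y) (All (\<lambda>x'. Cond (Q k (\<not> b) x' x) (Not (G x' y))))" for x y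
  define F2 where "F2 y x = Conj (Not (G x y)) (All (\<lambda>y'. Cond (Q k b y' y) (Not (Not (G x y')))))" for x y
  have dF1: "dtv (\<lambda>s. F1 x (s 0))" for x
    unfolding F1_def G_def Conj_def Q_def by (intro dtv_intros)
  have dF2: "dtv (\<lambda>s. F2 y (s 0))" for y
    unfolding F2_def G_def Conj_def Q_def by (intro dtv_intros)
  have dG: "dtv (\<lambda>s. Not (G (s 0) y))" "dtv (\<lambda>s. Not (Not (G x (s 0))))" for x y
    unfolding G_def by (intro dtv_intros)+
  let ?b1 = "V 4 \<sqdot> lam 5 (lam 6 (V 4 \<sqdot> lam 7 (lam 8 (V 7 \<sqdot> V 6))))"
  let ?b2 = "V 4 \<sqdot> lam 5 (lam 6 (V 4 \<sqdot> lam 7 (lam 8 (V 7 \<sqdot> lam 9 (V 6 \<sqdot> V 9)))))"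
  show ?thesis unfolding incompatible_def
  proof (intro typed_lam env)
    fix g0 h0 assume g0: "g0 \<Vdash> DF b" and h0: "h0 \<Vdash> DF (\<not> b)" and env2: "env (\<rho>(0 := g0, 1 := h0))"
    let ?r = "\<rho>(0 := g0, 1 := h0)"
    have ph1: "\<exists>y. E y k \<and> (\<forall>x. E x k \<longrightarrow> ev ?r (lam 4 ?b1) \<Vdash> Not (F1 x y))"
    proof (rule pigeonhole_bool[OF k e dF1 env2])
      fix x y z a assume xyz: "E x k" "E y k" "E z k" "b \<longrightarrow> E y z"
        and a: "a \<Vdash> F1 x y" "a \<Vdash> F1 x z" and env3: "env (?r(4 := a))"
      let ?r4 = "?r(4 := a)"
      have "?r4 \<turnstile> V 4 \<triangleright> F1 x y" using a env3 by (simp add: typed_V)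
      then show "?r4 \<turnstile> ?b1 \<triangleright> Bot" unfolding F1_def
      proof (rule typed_ConjE)
        fix p n assume n: "n \<Vdash> All (\<lambda>x'. Cond (Q k (\<not> b) x' x) (Not (G x' y)))"
          and env5: "env (?r4(5 := p, 6 := n))"
        let ?r6 = "?r4(5 := p, 6 := n)"
        have "?r6 \<turnstile> V 4 \<triangleright> F1 x z" using a env5 by (simp add: typed_V)
        then show "?r6 \<turnstile> V 4 \<sqdot> lam 7 (lam 8 (V 7 \<sqdot> V 6)) \<triangleright> Bot" unfolding F1_def
        proof (rule typed_ConjE)
          fix p' n' assume p': "p' \<Vdash> G x z" and env8: "env (?r6(7 := p', 8 := n'))"
          \<comment> \<open>\<open>G x z\<close> at the predecessor \<open>y\<close> of
            \<open>z\<close> yields some \<open>x'\<close> below \<open>x\<close> with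
            \<open>G x' y\<close>, against the minimality of \<open>x\<close> for
            \<open>y\<close>.\<close>
          have "Q k b y z" using xyz by (simp add: Q_def)
          then have "p' \<Vdash> Not (All (\<lambda>x'. Cond (Q k (\<not> b) x' x) (Not (G x' y))))"
            using realizes_All_CondE[OF p'[unfolded realizes_cong[OF G[OF xyz(1,3)]]]] by blast
          then show "?r6(7 := p', 8 := n') \<turnstile> V 7 \<sqdot> V 6 \<triangleright> Bot"
            using n env8 by (intro typed_notE[OF typed_VI typed_VI]) simp_all
        qed
      qed
    next
      fix x x' y assume b
      then show "F1 x y = F1 x' y" unfolding F1_def G_def Q_def by simp
    qed
    have ph2: "\<exists>x. E x k \<and> (\<forall>y. E y k \<longrightarrow> ev ?r (lam 4 ?b2) \<Vdash> Not (F2 y x))"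
    proof (rule pigeonhole_bool[OF k e dF2 env2, of "\<not> b"])
      fix y x z a assume xyz: "E y k" "E x k" "E z k" "\<not> b \<longrightarrow> E x z"
        and a: "a \<Vdash> F2 y x" "a \<Vdash> F2 y z" and env3: "env (?r(4 := a))"
      let ?r4 = "?r(4 := a)"
      have "?r4 \<turnstile> V 4 \<triangleright> F2 y x" using a env3 by (simp add: typed_V)
      then show "?r4 \<turnstile> ?b2 \<triangleright> Bot" unfolding F2_def
      proof (rule typed_ConjE)
        fix p m assume m: "m \<Vdash> All (\<lambda>y'. Cond (Q k b y' y) (Not (Not (G x y'))))"
          and env5: "env (?r4(5 := p, 6 := m))"
        let ?r6 = "?r4(5 := p, 6 := m)"
        have "?r6 \<turnstile> V 4 \<triangleright> F2 y z" using a env5 by (simp add: typed_V)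
        then show "?r6 \<turnstile> V 4 \<sqdot> lam 7 (lam 8 (V 7 \<sqdot> lam 9 (V 6 \<sqdot> V 9))) \<triangleright> Bot" unfolding F2_def
        proof (rule typed_ConjE)
          fix n' m' assume n': "n' \<Vdash> Not (G z y)" and env8: "env (?r6(7 := n', 8 := m'))"
          let ?r8 = "?r6(7 := n', 8 := m')"
          have "?r8 \<turnstile> V 7 \<triangleright> Not (G z y)" using n' env8 by (simp add: typed_V)
          \<comment> \<open>By minimality of \<open>y\<close> for \<open>x\<close>, each
            \<open>y'\<close> below \<open>y\<close> satisfies \<open>G x y'\<close>; as
            \<open>x\<close> is below \<open>z\<close>, this gives \<open>G z y\<close>.\<close>
          moreover have "?r8 \<turnstile> lam 9 (V 6 \<sqdot> V 9) \<triangleright> G z y"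
            unfolding typed_cong[OF G[OF xyz(3,1)]]
          proof (intro typed_allI typed_condI typed_notI env8)
            fix y' q assume y': "Q k b y' y"
              and q: "q \<Vdash> All (\<lambda>x'. Cond (Q k (\<not> b) x' z) (Not (G x' y')))"
              and env9: "env (?r8(9 := q))"
            have "Q k (\<not> b) x z" using xyz by (simp add: Q_def)
            with q have "q \<Vdash> Not (G x y')" by (rule realizes_All_CondE)
            moreover from m y' have "m \<Vdash> Not (Not (G x y'))" by (rule realizes_All_CondE)
            ultimately show "?r8(9 := q) \<turnstile> V 6 \<sqdot> V 9 \<triangleright> Bot"
              using env9 by (intro typed_notE[OF typed_VI typed_VI]) simp_all
          qed
          ultimately show "?r8 \<turnstile> V 7 \<sqdot> lam 9 (V 6 \<sqdot> V 9) \<triangleright> Bot" by (rule typed_notE)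
        qed
      qed
    next
      fix y y' x assume "\<not> b"
      then show "F2 y x = F2 y' x" unfolding F2_def G_def Q_def by simp
    qed
    obtain y0 where y0: "E y0 k" and n1: "\<And>x. E x k \<Longrightarrow> ev ?r (lam 4 ?b1) \<Vdash> Not (F1 x y0)"
      using ph1 by blast
    obtain x0 where x0: "E x0 k" and n2: "\<And>y. E y k \<Longrightarrow> ev ?r (lam 4 ?b2) \<Vdash> Not (F2 y x0)"
      using ph2 by blast
    let ?P1 = "All (\<lambda>x. Cond (E x k) (Not (F1 x y0)))"
    let ?P2 = "All (\<lambda>y. Cond (E y k) (Not (F2 y x0)))"
    let ?body = "V 0 \<sqdot> lam 4 (lam 5 (V 3 \<sqdot> lam 6 (V 6 \<sqdot> V 5 \<sqdot> V 4))) \<sqdot>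
       (V 1 \<sqdot> lam 4 (lam 5 (V 2 \<sqdot> lam 6 (V 6 \<sqdot> V 5 \<sqdot> V 4))))"
    have "?r \<turnstile> lam 2 (lam 3 ?body) \<triangleright> Imp ?P1 (Imp ?P2 Bot)"
    proof (intro typed_lam env2)
      fix n1 n2 assume n1: "n1 \<Vdash> ?P1" and n2: "n2 \<Vdash> ?P2" and env4: "env (?r(2 := n1, 3 := n2))"
      let ?r4 = "?r(2 := n1, 3 := n2)"
      have "?r4 \<turnstile> V 0 \<triangleright> DF b" using g0 env4 by (simp add: typed_V)
      \<comment> \<open>No \<open>y\<close> is minimal with \<open>G x0 y\<close> false, so
        induction along \<open>b\<close> gives \<open>G x0 y0\<close> up to double negation.\<close>
      then have "?r4 \<turnstile> V 0 \<sqdot> lam 4 (lam 5 (V 3 \<sqdot> lam 6 (V 6 \<sqdot> V 5 \<sqdot> V 4))) \<triangleright> Not (Not (G x0 y0))"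
      proof (rule DF_induct[OF dG(2)[of x0], where a = k])
        fix y u assume y: "E y k" and u: "u \<Vdash> All (\<lambda>y'. Cond (E y' k \<and> rel b y' y) (Not (Not (G x0 y'))))"
          and env5: "env (?r4(4 := u))"
        let ?r5 = "?r4(4 := u)"
        show "?r5 \<turnstile> lam 5 (V 3 \<sqdot> lam 6 (V 6 \<sqdot> V 5 \<sqdot> V 4)) \<triangleright> Not (Not (G x0 y))"
        proof (rule typed_notI[OF env5])
          fix p assume p: "p \<Vdash> Not (G x0 y)" and env6: "env (?r5(5 := p))"
          have "n2 \<Vdash> Not (F2 y x0)" using realizes_All_CondE[OF n2 y] .
          then have "?r5(5 := p) \<turnstile> V 3 \<triangleright> Not (F2 y x0)" using env6 by (simp add: typed_V)
          moreover have "?r5(5 := p) \<turnstile> lam 6 (V 6 \<sqdot> V 5 \<sqdot> V 4) \<triangleright> F2 y x0" unfolding F2_def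
          proof (rule typed_ConjI[OF env6])
            fix l assume env7: "env (?r5(5 := p, 6 := l))"
            show "?r5(5 := p, 6 := l) \<turnstile> V 5 \<triangleright> Not (G x0 y)" using p env7 by (simp add: typed_V)
            have "u \<Vdash> All (\<lambda>y'. Cond (Q k b y' y) (Not (Not (G x0 y'))))"
              by (intro realizes_All_CondI realizes_All_CondE[OF u] realizes_T[OF u])
                 (auto simp: Q_def rel_def below_mem)
            then show "?r5(5 := p, 6 := l) \<turnstile> V 4 \<triangleright> All (\<lambda>y'. Cond (Q k b y' y) (Not (Not (G x0 y'))))"
              using env7 by (simp add: typed_V)
          qed
          ultimately show "?r5(5 := p) \<turnstile> V 3 \<sqdot> lam 6 (V 6 \<sqdot> V 5 \<sqdot> V 4) \<triangleright> Bot" by (rule typed_notE)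
        qed
      qed (rule y0)
      moreover have "?r4 \<turnstile> V 1 \<triangleright> DF (\<not> b)" using h0 env4 by (simp add: typed_V)
      \<comment> \<open>Dually, no \<open>x\<close> is minimal with \<open>G x y0\<close>, so
        induction along \<open>\<not> b\<close> refutes \<open>G x0 y0\<close>.\<close>
      then have "?r4 \<turnstile> V 1 \<sqdot> lam 4 (lam 5 (V 2 \<sqdot> lam 6 (V 6 \<sqdot> V 5 \<sqdot> V 4))) \<triangleright> Not (G x0 y0)"
      proof (rule DF_induct[OF dG(1)[of y0], where a = k])
        fix x u assume x: "E x k" and u: "u \<Vdash> All (\<lambda>x'. Cond (E x' k \<and> rel (\<not> b) x' x) (Not (G x' y0)))"
          and env5: "env (?r4(4 := u))"
        let ?r5 = "?r4(4 := u)"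
        show "?r5 \<turnstile> lam 5 (V 2 \<sqdot> lam 6 (V 6 \<sqdot> V 5 \<sqdot> V 4)) \<triangleright> Not (G x y0)"
        proof (rule typed_notI[OF env5])
          fix p assume p: "p \<Vdash> G x y0" and env6: "env (?r5(5 := p))"
          have "n1 \<Vdash> Not (F1 x y0)" using realizes_All_CondE[OF n1 x] .
          then have "?r5(5 := p) \<turnstile> V 2 \<triangleright> Not (F1 x y0)" using env6 by (simp add: typed_V)
          moreover have "?r5(5 := p) \<turnstile> lam 6 (V 6 \<sqdot> V 5 \<sqdot> V 4) \<triangleright> F1 x y0" unfolding F1_def
          proof (rule typed_ConjI[OF env6])
            fix l assume env7: "env (?r5(5 := p, 6 := l))"
            show "?r5(5 := p, 6 := l) \<turnstile> V 5 \<triangleright> G x y0" using p env7 by (simp add: typed_V)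
            have "u \<Vdash> All (\<lambda>x'. Cond (Q k (\<not> b) x' x) (Not (G x' y0)))"
              by (intro realizes_All_CondI realizes_All_CondE[OF u] realizes_T[OF u])
                 (auto simp: Q_def rel_def below_mem)
            then show "?r5(5 := p, 6 := l) \<turnstile> V 4 \<triangleright> All (\<lambda>x'. Cond (Q k (\<not> b) x' x) (Not (G x' y0)))"
              using env7 by (simp add: typed_V)
          qed
          ultimately show "?r5(5 := p) \<turnstile> V 2 \<sqdot> lam 6 (V 6 \<sqdot> V 5 \<sqdot> V 4) \<triangleright> Bot" by (rule typed_notE)
        qed
      qed (rule x0)
      ultimately show "?r4 \<turnstile> ?body \<triangleright> Bot" by (rule typed_notE)
    qed
    moreover have "ev ?r (lam 4 ?b1) \<Vdash> ?P1"
      by (rule realizes_All_CondI[OF ev_T[OF env2]]) (rule n1)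
    moreover have "ev ?r (lam 4 ?b2) \<Vdash> ?P2"
      by (rule realizes_All_CondI[OF ev_T[OF env2]]) (rule n2)
    ultimately show "?r \<turnstile> lam 2 (lam 3 ?body) \<sqdot> lam 4 ?b1 \<sqdot> lam 4 ?b2 \<triangleright> Bot"
      by (rule typed_app[OF typed_app])
  qed
qed


section \<open>Descending sets\<close>

text \<open>If the truth value is empty, every term realizes \<open>F\<close>. Assuming it nonempty
  confines an element of a set to the domain of that set in the ground model.\<close>

lemma typed_contradiction':
  assumes env: "env \<rho>" and t: "\<And>k. tv E A F \<noteq> {} \<Longrightarrow> k \<Vdash> Not F \<Longrightarrow> env (\<rho>(x := k)) \<Longrightarrow>
    \<rho>(x := k) \<turnstile> t \<triangleright> Bot"
  shows "\<rho> \<turnstile> Co KCC \<sqdot> lam x t \<triangleright> F"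
proof (cases "tv E A F = {}")
  case True
  then show ?thesis using env by (simp only: typed_def ball_empty simp_thms)
next
  case False
  show ?thesis by (rule typed_contradiction[OF env t[OF False]])
qed

text \<open>With Kuratowski pairs, the first components of members of \<open>X\<close> lie in the
  union of the union of \<open>X\<close>.\<close>

lemma ex_domain: "\<exists>a. \<forall>u. tv E A (NotEps u X) \<noteq> {} \<longrightarrow> E u a"
proof -
  obtain v where v: "\<And>z. E z v \<longleftrightarrow> (\<exists>y. E y X \<and> E z y)" using ex_Union[of X] by auto
  obtain w where w: "\<And>z. E z w \<longleftrightarrow> (\<exists>y. E y v \<and> E z y)" using ex_Union[of v] by auto
  have "E u w" if "E (opair E u \<pi>) X" for u \<pi>
  proof -
    have "E (upair E u u) (opair E u \<pi>)" unfolding opair_def mem_upair by simp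
    with that have "E (upair E u u) v" unfolding v by (intro exI conjI)
    moreover have "E u (upair E u u)" unfolding mem_upair by simp
    ultimately show "E u w" unfolding w by (intro exI conjI)
  qed
  then show ?thesis by (intro exI[of _ w]) auto
qed

text \<open>\<open>Prod\<close> is negated membership in the projection of \<open>Y \<times> Z\<close> to its first component for d true, to
  its second for d false. It makes a set descending along \<open>d \<or> c\<close> from one along d and one along c.\<close>

definition Prod :: "bool \<Rightarrow> 'm \<Rightarrow> 'm \<Rightarrow> 'm \<Rightarrow> 'm zfe" where
  "Prod d Y Z w = All (\<lambda>o'. Imp (Eps (if d then w else o') Y) (Imp (Eps (if d then o' else w) Z) Bot))"

lemma dtv_Prod: "dtv (\<lambda>s. Prod d Y Z (s 0))"
  unfolding Prod_def Eps_def by (intro dtv_intros)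

text \<open>Comprehension realizes \<open>Prod\<close> only over a bounding set: exactly at pairs
  from the two domains, and elsewhere exactly or with an empty truth value.\<close>

definition is_Prod :: "bool \<Rightarrow> 'm \<Rightarrow> 'm \<Rightarrow> 'm \<Rightarrow> bool" where
  "is_Prod d Y Z X \<longleftrightarrow> (\<forall>u v. tv E A (NotEps u Y) \<noteq> {} \<longrightarrow> tv E A (NotEps v Z) \<noteq> {} \<longrightarrow>
      tv E A (NotEps (if d then u else v) X) = tv E A (Prod d Y Z (if d then u else v)))
    \<and> (\<forall>w. tv E A (NotEps w X) = {} \<or> tv E A (NotEps w X) = tv E A (Prod d Y Z w))"

lemma is_Prod_pair: "is_Prod d Y Z X \<Longrightarrow> tv E A (NotEps u Y) \<noteq> {} \<Longrightarrow> tv E A (NotEps v Z) \<noteq> {} \<Longrightarrow>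
    tv E A (NotEps (if d then u else v) X) = tv E A (Prod d Y Z (if d then u else v))"
  unfolding is_Prod_def by (simp del: tv.simps)

lemma is_Prod_cases: "is_Prod d Y Z X \<Longrightarrow>
    tv E A (NotEps w X) = {} \<or> tv E A (NotEps w X) = tv E A (Prod d Y Z w)"
  unfolding is_Prod_def by (simp del: tv.simps)

lemma ex_Prod: "\<exists>X. is_Prod d Y Z X"
proof -
  obtain a where a: "\<And>u. tv E A (NotEps u (if d then Y else Z)) \<noteq> {} \<Longrightarrow> E u a"
    using ex_domain[of "if d then Y else Z"] by blast
  obtain X where X: "\<And>w. tv E A (NotEps w X) = (if E w a then tv E A (Prod d Y Z w) else {})"
    using comprehension[OF dtv_Prod, of a] by blast
  have "E (if d then u else v) a" if "tv E A (NotEps u Y) \<noteq> {}" "tv E A (NotEps v Z) \<noteq> {}" for u v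
    using a[of "if d then u else v"] that by (cases d) simp_all
  then show ?thesis unfolding is_Prod_def by (intro exI[of _ X]) (simp add: X del: tv.simps)
qed

definition combine :: "tm \<Rightarrow> tm \<Rightarrow> tm" where
  "combine e f = lam 12 (lam 13 (lam 14 (V 13 \<sqdot> (e \<sqdot> (Co KCC \<sqdot> lam 15 (V 14 \<sqdot>
    (f \<sqdot> (Co KCC \<sqdot> lam 16 (V 12 \<sqdot> V 15 \<sqdot> V 16)))))))))"

text \<open>Both components of a pair descend, the first along \<open>d\<close>, the second along
  \<open>c\<close>. The one that is kept moves along \<open>d \<or> c\<close>: for \<open>d\<close>
  true it is the first, for \<open>d\<close> false the second.\<close>

lemma typed_combine:
  assumes env: "env \<rho>" and e: "\<rho> 3 \<Vdash> Desc d Y" and f: "\<rho> 10 \<Vdash> Desc c Z"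
    and X: "is_Prod d Y Z X"
  shows "\<rho> \<turnstile> combine (V 3) (V 10) \<triangleright> Desc (d \<or> c) X"
  unfolding combine_def Desc_def
proof (intro typed_allI typed_lam env)
  fix w h assume h: "h \<Vdash> All (\<lambda>w'. Cond (rel (d \<or> c) w' w) (NotEps w' X))"
    and env12: "env (\<rho>(12 := h))"
  let ?r12 = "\<rho>(12 := h)"
  let ?t = "lam 13 (lam 14 (V 13 \<sqdot> (V 3 \<sqdot> (Co KCC \<sqdot> lam 15 (V 14 \<sqdot>
    (V 10 \<sqdot> (Co KCC \<sqdot> lam 16 (V 12 \<sqdot> V 15 \<sqdot> V 16))))))))"
  have "?r12 \<turnstile> ?t \<triangleright> Prod d Y Z w" unfolding Prod_def
  proof (intro typed_allI typed_lam env12)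
    fix w2 y m assume y: "y \<Vdash> Eps (if d then w else w2) Y" and m: "m \<Vdash> Eps (if d then w2 else w) Z"
      and env14: "env (?r12(13 := y, 14 := m))"
    let ?r14 = "?r12(13 := y, 14 := m)"
    let ?u = "if d then w else w2" and ?v = "if d then w2 else w"
    let ?s = "V 14 \<sqdot> (V 10 \<sqdot> (Co KCC \<sqdot> lam 16 (V 12 \<sqdot> V 15 \<sqdot> V 16)))"
    have y': "?r14 \<turnstile> V 13 \<triangleright> Not (NotEps ?u Y)" using y env14 by (simp add: typed_V Eps_def)
    have "?r14 \<turnstile> V 3 \<triangleright> Desc d Y" using e env14 by (simp add: typed_V)
    then have "?r14 \<turnstile> V 3 \<triangleright> Imp (All (\<lambda>y. Cond (rel d y ?u) (NotEps y Y))) (NotEps ?u Y)"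
      unfolding Desc_def by (rule typed_allE)
    moreover have "?r14 \<turnstile> Co KCC \<sqdot> lam 15 ?s \<triangleright> All (\<lambda>y. Cond (rel d y ?u) (NotEps y Y))"
    proof (rule typed_allI, rule typed_condI[OF env14], rule typed_contradiction'[OF env14])
      fix u l assume u: "rel d u ?u" "tv E A (NotEps u Y) \<noteq> {}" and l: "l \<Vdash> Not (NotEps u Y)"
        and env15: "env (?r14(15 := l))"
      let ?r15 = "?r14(15 := l)"
      have m': "?r15 \<turnstile> V 14 \<triangleright> Not (NotEps ?v Z)" using m env15 by (simp add: typed_V Eps_def)
      have "?r15 \<turnstile> V 10 \<triangleright> Desc c Z" using f env15 by (simp add: typed_V)
      then have "?r15 \<turnstile> V 10 \<triangleright> Imp (All (\<lambda>y. Cond (rel c y ?v) (NotEps y Z))) (NotEps ?v Z)"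
        unfolding Desc_def by (rule typed_allE)
      moreover have "?r15 \<turnstile> Co KCC \<sqdot> lam 16 (V 12 \<sqdot> V 15 \<sqdot> V 16) \<triangleright> All (\<lambda>y. Cond (rel c y ?v) (NotEps y Z))"
      proof (rule typed_allI, rule typed_condI[OF env15], rule typed_contradiction'[OF env15])
        fix v l' assume v: "rel c v ?v" "tv E A (NotEps v Z) \<noteq> {}" and l': "l' \<Vdash> Not (NotEps v Z)"
          and env16: "env (?r15(16 := l'))"
        let ?r16 = "?r15(16 := l')"
        let ?w = "if d then u else v" and ?o = "if d then v else u"
        have "rel (d \<or> c) ?w w" using u(1) v(1) by (cases d) (simp_all add: rel_def)
        with h have "h \<Vdash> NotEps ?w X" by (rule realizes_All_CondE)
        then have "h \<Vdash> Prod d Y Z ?w" unfolding realizes_cong[OF is_Prod_pair[OF X u(2) v(2)]] .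
        then have "h \<Vdash> Imp (Eps (if d then ?w else ?o) Y) (Imp (Eps (if d then ?o else ?w) Z) Bot)"
          unfolding Prod_def realizes_All by (rule spec)
        then have "h \<Vdash> Imp (Eps u Y) (Imp (Eps v Z) Bot)" by (cases d) simp_all
        then show "?r16 \<turnstile> V 12 \<sqdot> V 15 \<sqdot> V 16 \<triangleright> Bot"
          using l l' env16 by (intro typed_mp[OF typed_mp[OF typed_VI typed_VI] typed_VI]) (simp_all add: Eps_def)
      qed
      ultimately show "?r15 \<turnstile> ?s \<triangleright> Bot" by (rule typed_notE[OF m' typed_mp])
    qed
    ultimately show "?r14 \<turnstile> V 13 \<sqdot> (V 3 \<sqdot> (Co KCC \<sqdot> lam 15 ?s)) \<triangleright> Bot"
      by (rule typed_notE[OF y' typed_mp])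
  qed
  then show "?r12 \<turnstile> ?t \<triangleright> NotEps w X"
  proof (cases "tv E A (NotEps w X) = {}")
    case True
    then show ?thesis using env12 by (simp only: typed_def ball_empty simp_thms)
  next
    case False
    then have eq: "tv E A (NotEps w X) = tv E A (Prod d Y Z w)" using is_Prod_cases[OF X, of w] by (simp del: tv.simps)
    show ?thesis unfolding typed_cong[OF eq] by (rule \<open>?r12 \<turnstile> ?t \<triangleright> Prod d Y Z w\<close>)
  qed
qed

end

locale krivine = ralg E A + zfl E for E :: "'m \<Rightarrow> 'm \<Rightarrow> bool" and A :: "'m realg"
begin

section \<open>The descent\<close>

text \<open>Variable 0 is the progressivity of X and 1 the recursive call. Variables 2, 3, 4
  describe the current triple; 6, 9, 11 witness the new x, the new element of Y and an element of Z;
  8 says that the new Boolean is in D, and 10 that Z descends.\<close>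

definition descent :: tm where
  "descent = lam 1 (lam 2 (lam 3 (lam 4 (V 2 \<sqdot> (V 0 \<sqdot> lam 5 (Co KCC \<sqdot> lam 6 (V 5 \<sqdot> lam 7 (lam 8
    (V 4 \<sqdot> (V 3 \<sqdot> (Co KCC \<sqdot> lam 9 (incompatible \<sqdot> V 8 \<sqdot> lam 10 (Co KCC \<sqdot> lam 11
      (V 1 \<sqdot> V 6 \<sqdot> combine (V 3) (V 10) \<sqdot> lam 17 (V 17 \<sqdot> V 9 \<sqdot> V 11)))))))))))))))"

definition Progressive :: "('m \<Rightarrow> 'm \<Rightarrow> bool) \<Rightarrow> 'm \<Rightarrow> 'm zfe" where
  "Progressive R X = All (\<lambda>x. Imp (All (\<lambda>y. Imp (Eps_D E A (chi E R y x)) (NotEps y X))) (NotEps x X))"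

text \<open>For d false the pair (x, u) stands for x, for d true it stands for u. The recursive calls go
  to smaller pairs, where all pairs with d true are below all those with d false. In \<open>Hyp\<close> the individual s encodes
  the Boolean of the smaller pair, since formulas quantify over individuals only.\<close>

definition Claim :: "'m \<Rightarrow> bool \<Rightarrow> 'm \<Rightarrow> 'm \<Rightarrow> 'm \<Rightarrow> 'm zfe" where
  "Claim X d x Y u = Imp (Eps x X) (Imp (Desc d Y) (Imp (Eps u Y) Bot))"

definition Hyp :: "('m \<Rightarrow> 'm \<Rightarrow> bool) \<Rightarrow> 'm \<Rightarrow> bool \<Rightarrow> 'm \<Rightarrow> 'm \<Rightarrow> 'm zfe" where
  "Hyp R X d x u = All (\<lambda>s. All (\<lambda>y. All (\<lambda>Y. All (\<lambda>w.
    Cond (if d then s = zero E \<and> below E w u else s = zero E \<or> R y x \<and> tv E A (NotEps y X) \<noteq> {})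
      (Claim X (s = zero E) y Y w)))))"

lemma Hyp_elim:
  assumes "\<theta> \<Vdash> Hyp R X d x u"
    and "if d then d' \<and> below E w u else d' \<or> R y x \<and> tv E A (NotEps y X) \<noteq> {}"
  shows "\<theta> \<Vdash> Claim X d' y Y w"
proof -
  let ?s = "if d' then zero E else one E"
  have s: "?s = zero E \<longleftrightarrow> d'" by simp
  have "\<theta> \<Vdash> Cond (if d then ?s = zero E \<and> below E w u else ?s = zero E \<or> R y x \<and> tv E A (NotEps y X) \<noteq> {})
      (Claim X (?s = zero E) y Y w)"
    using assms(1) unfolding Hyp_def realizes_All by (elim allE)
  then show ?thesis using assms(2) unfolding realizes_Cond s by blast
qed

text \<open>Here \<open>d\<close> is the complement of the Boolean \<beta> of the triple and
  \<open>c\<close> is \<gamma>, so the product descends along \<open>d \<or> \<not> c\<close>, the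
  complement of \<beta>\<gamma>.\<close>

lemma typed_descent:
  assumes env: "env \<rho>" and \<eta>: "\<rho> 0 \<Vdash> Progressive R X"
  shows "\<rho> \<turnstile> descent \<triangleright> Imp (Hyp R X d x u) (Claim X d x Y u)"
  unfolding descent_def Claim_def
proof (intro typed_lam env)
  fix \<theta> \<xi> e \<upsilon>
  assume \<theta>: "\<theta> \<Vdash> Hyp R X d x u" and \<xi>: "\<xi> \<Vdash> Eps x X" and e: "e \<Vdash> Desc d Y" and \<upsilon>: "\<upsilon> \<Vdash> Eps u Y"
    and env4: "env (\<rho>(1 := \<theta>, 2 := \<xi>, 3 := e, 4 := \<upsilon>))"
  let ?r4 = "\<rho>(1 := \<theta>, 2 := \<xi>, 3 := e, 4 := \<upsilon>)"
  let ?call = "V 1 \<sqdot> V 6 \<sqdot> combine (V 3) (V 10) \<sqdot> lam 17 (V 17 \<sqdot> V 9 \<sqdot> V 11)"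
  let ?t10 = "lam 10 (Co KCC \<sqdot> lam 11 ?call)"
  let ?t8 = "V 4 \<sqdot> (V 3 \<sqdot> (Co KCC \<sqdot> lam 9 (incompatible \<sqdot> V 8 \<sqdot> ?t10)))"
  let ?t5 = "lam 5 (Co KCC \<sqdot> lam 6 (V 5 \<sqdot> lam 7 (lam 8 ?t8)))"
  have "?r4 \<turnstile> V 2 \<triangleright> Not (NotEps x X)" using \<xi> env4 by (simp add: typed_V Eps_def)
  moreover have "?r4 \<turnstile> V 0 \<sqdot> ?t5 \<triangleright> NotEps x X"
  proof (rule typed_mp)
    have "?r4 \<turnstile> V 0 \<triangleright> Progressive R X" using \<eta> env4 by (simp add: typed_V)
    then show "?r4 \<turnstile> V 0 \<triangleright> Imp (All (\<lambda>y. Imp (Eps_D E A (chi E R y x)) (NotEps y X))) (NotEps x X)"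
      unfolding Progressive_def by (rule typed_allE)
    show "?r4 \<turnstile> ?t5 \<triangleright> All (\<lambda>y. Imp (Eps_D E A (chi E R y x)) (NotEps y X))"
    proof (rule typed_allI, rule typed_lam[OF env4], rule typed_contradiction')
      fix y g k assume g: "g \<Vdash> Eps_D E A (chi E R y x)" and y: "tv E A (NotEps y X) \<noteq> {}"
        and k: "k \<Vdash> Not (NotEps y X)" and env6: "env (?r4(5 := g, 6 := k))"
      let ?r6 = "?r4(5 := g, 6 := k)"
      define c where "c = R y x"
      have "Eps_D E A (chi E R y x) = Conj (Eps (chi E R y x) (gimel2 E A)) (DF c)"
        unfolding Eps_D_def c_def by (simp add: D_formula_eq chi_def)
      with g env6 have "?r6 \<turnstile> V 5 \<triangleright> Conj (Eps (chi E R y x) (gimel2 E A)) (DF c)"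
        by (simp add: typed_V)
      then show "?r6 \<turnstile> V 5 \<sqdot> lam 7 (lam 8 ?t8) \<triangleright> Bot"
      proof (rule typed_ConjE)
        fix p \<delta> assume \<delta>: "\<delta> \<Vdash> DF c" and env8: "env (?r6(7 := p, 8 := \<delta>))"
        let ?r8 = "?r6(7 := p, 8 := \<delta>)"
        have "?r8 \<turnstile> V 4 \<triangleright> Not (NotEps u Y)" using \<upsilon> env8 by (simp add: typed_V Eps_def)
        moreover have "?r8 \<turnstile> V 3 \<sqdot> (Co KCC \<sqdot> lam 9 (incompatible \<sqdot> V 8 \<sqdot> ?t10)) \<triangleright> NotEps u Y"
        proof (rule typed_mp)
          have "?r8 \<turnstile> V 3 \<triangleright> Desc d Y" using e env8 by (simp add: typed_V)
          then show "?r8 \<turnstile> V 3 \<triangleright> Imp (All (\<lambda>y. Cond (rel d y u) (NotEps y Y))) (NotEps u Y)"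
            unfolding Desc_def by (rule typed_allE)
          show "?r8 \<turnstile> Co KCC \<sqdot> lam 9 (incompatible \<sqdot> V 8 \<sqdot> ?t10) \<triangleright> All (\<lambda>y. Cond (rel d y u) (NotEps y Y))"
          proof (rule typed_allI, rule typed_condI[OF env8], rule typed_contradiction'[OF env8])
            fix u' l assume u': "rel d u' u" "tv E A (NotEps u' Y) \<noteq> {}" and l: "l \<Vdash> Not (NotEps u' Y)"
              and env9: "env (?r8(9 := l))"
            let ?r9 = "?r8(9 := l)"
            \<comment> \<open>By incompatibility with \<open>DF c\<close>, it suffices to derive a
              contradiction from an arbitrary nonempty \<open>Z\<close> descending along
              \<open>\<not> c\<close>.\<close>
            have "?r9 \<turnstile> ?t10 \<triangleright> DF (\<not> c)" unfolding DF_def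
            proof (rule typed_allI, rule typed_lam[OF env9], rule typed_allI, rule typed_contradiction')
              fix Z f v m assume f: "f \<Vdash> Desc (\<not> c) Z" and v: "tv E A (NotEps v Z) \<noteq> {}"
                and m: "m \<Vdash> Not (NotEps v Z)" and env11: "env (?r9(10 := f, 11 := m))"
              let ?r11 = "?r9(10 := f, 11 := m)"
              obtain W where W: "is_Prod d Y Z W" using ex_Prod by blast
              let ?w = "if d then u' else v" and ?d = "d \<or> \<not> c" and ?o = "if d then v else u'"
              \<comment> \<open>The new pair is smaller: for \<open>d\<close> true,
                \<open>u'\<close> is below \<open>u\<close>; for \<open>d\<close> false, either
                \<open>c\<close> holds and \<open>y\<close> precedes \<open>x\<close>, or
                \<open>c\<close> fails and the new Boolean \<open>?d\<close> becomes true.\<close>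
              have "\<theta> \<Vdash> Claim X ?d y W ?w"
                using \<theta> by (rule Hyp_elim) (use u'(1) y in \<open>auto simp: rel_def c_def\<close>)
              then have "?r11 \<turnstile> V 1 \<triangleright> Imp (Eps y X) (Imp (Desc ?d W) (Imp (Eps ?w W) Bot))"
                using env11 by (simp add: typed_V Claim_def)
              moreover have "?r11 \<turnstile> V 6 \<triangleright> Eps y X" using k env11 by (simp add: typed_V Eps_def)
              moreover have "?r11 \<turnstile> combine (V 3) (V 10) \<triangleright> Desc ?d W"
                by (rule typed_combine[OF env11 _ _ W]) (use e f in simp_all)
              moreover have "?r11 \<turnstile> lam 17 (V 17 \<sqdot> V 9 \<sqdot> V 11) \<triangleright> Eps ?w W" unfolding Eps_def
              proof (rule typed_notI[OF env11])
                fix z assume z: "z \<Vdash> NotEps ?w W" and env17: "env (?r11(17 := z))"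
                from z have "z \<Vdash> Prod d Y Z ?w" unfolding realizes_cong[OF is_Prod_pair[OF W u'(2) v]] .
                then have "z \<Vdash> Imp (Eps (if d then ?w else ?o) Y) (Imp (Eps (if d then ?o else ?w) Z) Bot)"
                  unfolding Prod_def realizes_All by (rule spec)
                then have "z \<Vdash> Imp (Eps u' Y) (Imp (Eps v Z) Bot)" by (cases d) simp_all
                then have "?r11(17 := z) \<turnstile> V 17 \<triangleright> Imp (Eps u' Y) (Imp (Eps v Z) Bot)"
                  using env17 by (simp add: typed_V)
                moreover have "?r11(17 := z) \<turnstile> V 9 \<triangleright> Eps u' Y"
                  using l env17 by (simp add: typed_V Eps_def)
                moreover have "?r11(17 := z) \<turnstile> V 11 \<triangleright> Eps v Z"
                  using m env17 by (simp add: typed_V Eps_def)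
                ultimately show "?r11(17 := z) \<turnstile> V 17 \<sqdot> V 9 \<sqdot> V 11 \<triangleright> Bot"
                  by (rule typed_mp[OF typed_mp])
              qed
              ultimately show "?r11 \<turnstile> ?call \<triangleright> Bot" by (rule typed_mp[OF typed_mp[OF typed_mp]])
            qed
            moreover have "?r9 \<turnstile> V 8 \<triangleright> DF c" using \<delta> env9 by (simp add: typed_V)
            ultimately show "?r9 \<turnstile> incompatible \<sqdot> V 8 \<sqdot> ?t10 \<triangleright> Bot"
              by (intro typed_mp[OF typed_mp[OF typed_incompatible[OF env9]]])
          qed
        qed
        ultimately show "?r8 \<turnstile> ?t8 \<triangleright> Bot" by (rule typed_notE)
      qed
    qed
  qed
  ultimately show "?r4 \<turnstile> V 2 \<sqdot> (V 0 \<sqdot> ?t5) \<triangleright> Bot" by (rule typed_notE)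
qed

section \<open>Starting the descent\<close>

lemma typed_I:
  assumes "env \<rho>" "\<And>\<xi>. \<xi> \<Vdash> F \<Longrightarrow> \<xi> \<Vdash> G" shows "\<rho> \<turnstile> Co KI \<triangleright> Imp F G"
  unfolding typed_def tv_Imp
proof (intro conjI ballI)
  fix \<sigma> assume "\<sigma> \<in> {push E A \<xi> \<pi> | \<xi> \<pi>. \<xi> \<Vdash> F \<and> \<pi> \<in> tv E A G}"
  then obtain \<xi> \<pi> where \<sigma>: "\<sigma> = push E A \<xi> \<pi>" "\<xi> \<Vdash> F" "\<pi> \<in> tv E A G" by blast
  have "pl \<xi> \<pi>" using assms(2)[OF \<sigma>(2)] \<sigma>(3) by (simp only: realizes_def)
  then show "run \<rho> (Co KI) \<sigma>"
    unfolding \<sigma>(1) run.simps const.simps by (rule pole_I[OF realizes_T[OF \<sigma>(2)] tv_S[OF \<sigma>(3)]])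
qed (rule assms(1))

lemma dtv_Claim:
  assumes "df E x" "df E Y" "df E u"
  shows "dtv (\<lambda>s. Claim X d (x s) (Y s) (u s))"
  unfolding Claim_def Desc_def Eps_def rel_def
  by (intro dtv_intros dp_below df_ren[OF assms(2)] assms)

definition main :: tm where
  "main = lam 0 (Co KCC \<sqdot> lam 18 (fixpoint \<sqdot> descent \<sqdot> V 18 \<sqdot> Co KI \<sqdot> Co KI))"

text \<open>The fixed point realizes the claim at all pairs by two inductions in the ground model:
  along \<open>below\<close> for the Boolean true, then along \<open>R\<close> for the Boolean
  false. The descent starts at false, where the order on \<open>Y\<close> is trivial.\<close>

lemma typed_main:
  assumes wf: "wf_ground E R" and env: "env \<rho>"
  shows "\<rho> \<turnstile> main \<triangleright> wf_formula (\<lambda>x y. Eps_D E A (chi E R x y))"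
  unfolding main_def wf_formula_def Progressive_def[symmetric]
proof (rule typed_allI, rule typed_lam[OF env], rule typed_allI, rule typed_contradiction')
  fix X \<eta> x k
  assume \<eta>: "\<eta> \<Vdash> Progressive R X" and env0: "env (\<rho>(0 := \<eta>))"
    and x: "tv E A (NotEps x X) \<noteq> {}" and k: "k \<Vdash> Not (NotEps x X)"
    and env1: "env (\<rho>(0 := \<eta>, 18 := k))"
  let ?r = "\<rho>(0 := \<eta>, 18 := k)"
  let ?f = "fixpoint \<sqdot> descent"
  let ?c = "ev ?r ?f"
  have \<eta>': "?r 0 \<Vdash> Progressive R X" using \<eta> by simp
  have cT: "T ?c" using env1 by (rule ev_T)
  note rec = typed_fixpoint[OF env1 typed_descent[OF env1 \<eta>']]
  have True_case: "?c \<Vdash> All (\<lambda>x. All (\<lambda>Y. Claim X True x Y u))" for u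
  proof (rule below_induct[where P = "\<lambda>u. ?c \<Vdash> All (\<lambda>x. All (\<lambda>Y. Claim X True x Y u))"])
    show "dp E (\<lambda>s. ?c \<Vdash> All (\<lambda>x. All (\<lambda>Y. Claim X True x Y (s 0))))"
      by (intro dp_realizes df_const dtv_All dtv_Claim df_var)
    fix u assume IH: "\<And>u'. below E u' u \<Longrightarrow> ?c \<Vdash> All (\<lambda>x. All (\<lambda>Y. Claim X True x Y u'))"
    have "?c \<Vdash> Hyp R X True x u" for x
      unfolding Hyp_def realizes_All realizes_Cond
    proof (intro allI conjI impI cT)
      fix s y Y w
      assume "if True then s = zero E \<and> below E w u else s = zero E \<or> R y x \<and> tv E A (NotEps y X) \<noteq> {}"
      then have s: "s = zero E" and w: "below E w u" by simp_all
      show "?c \<Vdash> Claim X (s = zero E) y Y w" using IH[OF w] s unfolding realizes_All by simp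
    qed
    then show "?c \<Vdash> All (\<lambda>x. All (\<lambda>Y. Claim X True x Y u))"
      unfolding realizes_All by (intro allI typed_realizes[OF rec])
  qed
  have hyp: "?c \<Vdash> Hyp R X False x u"
    if "\<And>y. R y x \<Longrightarrow> tv E A (NotEps y X) \<noteq> {} \<Longrightarrow> ?c \<Vdash> All (\<lambda>Y. All (\<lambda>u. Claim X False y Y u))" for x u
    unfolding Hyp_def realizes_All realizes_Cond
  proof (intro allI conjI impI cT)
    fix s y Y w
    assume "if False then s = zero E \<and> below E w u else s = zero E \<or> R y x \<and> tv E A (NotEps y X) \<noteq> {}"
    then have *: "s \<noteq> zero E \<Longrightarrow> R y x \<and> tv E A (NotEps y X) \<noteq> {}" by (simp del: tv.simps)
    show "?c \<Vdash> Claim X (s = zero E) y Y w"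
    proof (cases "s = zero E")
      case True
      then show ?thesis using True_case[of w] unfolding realizes_All by simp
    next
      case False
      then show ?thesis using that[of y] * unfolding realizes_All by (simp del: tv.simps)
    qed
  qed
  obtain a where a: "\<And>u. tv E A (NotEps u X) \<noteq> {} \<Longrightarrow> E u a" using ex_domain[of X] by blast
  \<comment> \<open>\<open>wf_ground\<close> speaks of sets, so the counterexamples are collected
    within the domain \<open>a\<close> of \<open>X\<close>; this is why \<open>Hyp\<close> demands a
    nonempty truth value at \<open>y\<close>.\<close>
  have "dp E (\<lambda>s. \<not> ?c \<Vdash> All (\<lambda>Y. All (\<lambda>u. Claim X False (s 0) Y u)))"
    by (intro dp_not dp_realizes df_const dtv_All dtv_Claim df_var)
  from separation[OF this, of a] obtain U where
    U: "\<And>x. E x U \<longleftrightarrow> E x a \<and> \<not> ?c \<Vdash> All (\<lambda>Y. All (\<lambda>u. Claim X False x Y u))" by blast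
  have "\<forall>x. (\<forall>y. R y x \<longrightarrow> \<not> E y U) \<longrightarrow> \<not> E x U"
  proof (intro allI impI)
    fix x assume *: "\<forall>y. R y x \<longrightarrow> \<not> E y U"
    have "?c \<Vdash> Hyp R X False x u" for u
    proof (rule hyp)
      fix y assume "R y x" "tv E A (NotEps y X) \<noteq> {}"
      then show "?c \<Vdash> All (\<lambda>Y. All (\<lambda>u. Claim X False y Y u))" using *[THEN spec, of y] U[of y] a[of y] by (simp del: tv.simps)
    qed
    then have "?c \<Vdash> All (\<lambda>Y. All (\<lambda>u. Claim X False x Y u))"
      unfolding realizes_All by (intro allI typed_realizes[OF rec])
    then show "\<not> E x U" unfolding U by simp
  qed
  from mp[OF spec[OF wf[unfolded wf_ground_def], of U] this] have none: "\<not> E x U" for x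
    by (rule spec)
  have "dtv (\<lambda>s. Bot)" by (rule dtv_Bot)
  \<comment> \<open>\<open>Y\<close> is a copy of the singleton of 0: \<open>NotEps\<close> at 0 has
    the truth value of \<open>Bot\<close>. Hence \<open>KI\<close> realizes both that 0 is in
    \<open>Y\<close> and that \<open>Y\<close> descends along false.\<close>
  from comprehension[OF this, of "one E"] obtain Y where
    Y: "\<And>w. tv E A (NotEps w Y) = (if E w (one E) then tv E A Bot else {})" by blast
  have "?c \<Vdash> Hyp R X False x (zero E)"
  proof (rule hyp)
    fix y assume "tv E A (NotEps y X) \<noteq> {}"
    then show "?c \<Vdash> All (\<lambda>Y. All (\<lambda>u. Claim X False y Y u))" using none[of y] U[of y] a[of y] by (simp del: tv.simps)
  qed
  then have "?r \<turnstile> ?f \<triangleright> Claim X False x Y (zero E)" by (rule rec)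
  then have "?r \<turnstile> ?f \<triangleright> Imp (Eps x X) (Imp (Desc False Y) (Imp (Eps (zero E) Y) Bot))"
    unfolding Claim_def .
  moreover have "?r \<turnstile> V 18 \<triangleright> Eps x X" using k env1 by (simp add: typed_V Eps_def)
  moreover have "?r \<turnstile> Co KI \<triangleright> Desc False Y" unfolding Desc_def
  proof (rule typed_allI, rule typed_I[OF env1])
    fix x \<xi> assume "\<xi> \<Vdash> All (\<lambda>y. Cond (rel False y x) (NotEps y Y))"
    then show "\<xi> \<Vdash> NotEps x Y" by (rule realizes_All_CondE) (simp add: rel_def)
  qed
  moreover have "?r \<turnstile> Co KI \<triangleright> Eps (zero E) Y" unfolding Eps_def Not_def
  proof (rule typed_I[OF env1])
    have eq: "tv E A (NotEps (zero E) Y) = tv E A Bot" using Y mem_one by simp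
    fix \<xi> assume "\<xi> \<Vdash> NotEps (zero E) Y"
    then show "\<xi> \<Vdash> Bot" unfolding realizes_cong[OF eq] .
  qed
  ultimately show "?r \<turnstile> ?f \<sqdot> V 18 \<sqdot> Co KI \<sqdot> Co KI \<triangleright> Bot" by (rule typed_mp[OF typed_mp[OF typed_mp]])
qed

end

theorem theorem28:
  fixes E :: "'m \<Rightarrow> 'm \<Rightarrow> bool"
    and A :: "'m realg"
    and R :: "'m \<Rightarrow> 'm \<Rightarrow> bool"
  assumes "model_ZF E" and "V_eq_L E"
    and "realizability_algebra E A"
    and "definable2 E R"
    and "wf_ground E R"
  shows "holds E A (wf_formula (\<lambda>x y. Eps_D E A (chi E R x y)))"
proof -
  interpret krivine E A
    using assms(1-3) by unfold_locales
  \<comment> \<open>Filling every variable with the proof-like \<open>cI A\<close> makes the value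
    of \<open>main\<close> proof-like.\<close>
  let ?\<rho> = "\<lambda>_. cI A"
  have "E (cI A) (QP A)" using const_QP[of KI] by simp
  then have "E (ev ?\<rho> main) (QP A)" by (rule ev_QP)
  moreover have "env ?\<rho>" unfolding env_def using consts_T(3) by simp
  then have "ev ?\<rho> main \<Vdash> wf_formula (\<lambda>x y. Eps_D E A (chi E R x y))"
    by (rule typed_realizes[OF typed_main[OF assms(5)]])
  ultimately show ?thesis unfolding holds_def by blast
qed

end
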